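(* Let $(G,C)$ be an ergodic measured groupoid such that $H^1((G,C),L)=0$ for every representation $L$ of $(G,C)$ in a complex Hilbert bundle over $G^{(0)}$. Then $(G,C)$ has property $T$.
   Context: Conventions: Borel spaces are standard, Hilbert spaces are separable. For a groupoid $G$: $G^{(0)}$ is the unit space, $r,s:G\to G^{(0)}$ the range and source maps, $G^x=r^{-1}(x)$; for $A\subset G^{(0)}$, $G|_A=\{\gamma: r(\gamma)\in A,\ s(\gamma)\in A\}$, and $A$ is invariant if $s(r^{-1}(A))=A$. A Borel groupoid is a groupoid with a Borel structure for which all operations are Borel. A measure class $C$ on $G$ is symmetric if each $\nu\in C$ is equivalent to its image under inversion; it is invariant if some probability measure $\nu\in C$ has a disintegration $(\nu^x)$ along $r$ with $\gamma\nu^{s(\gamma)}$ equivalent to $\nu^{r(\gamma)}$ for almost every $\gamma$. A measured groupoid is a pair $(G,C)$ with $G$ a Borel groupoid and $C$ a symmetric invariant measure class; $r(C)$ is the class of $r_*\nu$, $\nu\in C$ a probability measure. "Null, conull" in $G^{(0)}$ refer to $r(C)$. An inessential reduction is $(G|_U,C|_U)$ with $U\subset G^{(0)}$ conull Borel. $(G,C)$ is ergodic if every invariant Borel subset of $G^{(0)}$ is null or conull. A Hilbert bundle over a Borel space is a Borel field of separable Hilbert spaces; sections are Borel. A representation of $(G,C)$ in a Hilbert bundle $\mathcal{H}$ over $G^{(0)}$ is a Borel map $\gamma\mapsto L(\gamma)$, with $L(\gamma):\mathcal{H}(s(\gamma))\to\mathcal{H}(r(\gamma))$ a Hilbert space isomorphism,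 such that on some inessential reduction $L(\gamma_1\gamma_2)=L(\gamma_1)L(\gamma_2)$ for all composable pairs. An $L$-cocycle is a Borel map $b$ with $b(\gamma)\in\mathcal{H}(r(\gamma))$ such that on some inessential reduction $b(\gamma_1\gamma_2)=b(\gamma_1)+L(\gamma_1)b(\gamma_2)$ for all composable pairs. It is an $L$-coboundary if there is a Borel section $\xi$ of $\mathcal{H}$ with $b(\gamma)=\xi(r(\gamma))-L(\gamma)\xi(s(\gamma))$ for $C$-almost every $\gamma$. $H^1((G,C),L)$ is the quotient of the space of $L$-cocycles (modulo equality $C$-a.e.) by the subspace of $L$-coboundaries. A unit section is a Borel section $\xi$ of $\mathcal{H}$ with $\|\xi(x)\|=1$ a.e. $L$ almost contains unit invariant sections if there is a sequence $(\xi_n)$ of unit sections with $\|\xi_n(r(\gamma))-L(\gamma)\xi_n(s(\gamma))\|\to 0$ for $C$-a.e. $\gamma$; $L$ contains a unit invariant section if there is a unit section $\xi$ with $\xi(r(\gamma))=L(\gamma)\xi(s(\gamma))$ for $C$-a.e. $\gamma$. $(G,C)$ has property $T$ (is Kazhdan) if every representation (in a complex Hilbert bundle) that almost contains unit invariant sections contains a unit invariant section.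
   Formalization: Invariance of C is required for all γ in an inessential reduction, not just for almost every γ (as literally stated the claim fails for SL(3,Z) with C carried by an infinite cyclic subgroup); Hilbert bundles have fibres consisting of complex sequences, which covers all up to isomorphism. *)

theory Defs
  imports "HOL-Algebra.Module" "HOL-Probability.Probability"
begin

section \<open>Borel spaces and measure classes\<close>

text \<open>A Borel space is represented by a measure whose values are ignored: only its
  \<open>space\<close> and \<open>sets\<close> matter.\<close>

definition standard_borel :: "'a measure \<Rightarrow> bool" where
  "standard_borel M \<longleftrightarrow>
     (\<exists>T. completely_metrizable_space T \<and> second_countable T \<and> topspace T = space M \<and>
          sets M = sigma_sets (topspace T) {U. openin T U})"

definition equivalent_measures :: "'a measure \<Rightarrow> 'a measure \<Rightarrow> bool" where
  "equivalent_measures \<mu> \<nu> \<longleftrightarrow>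
     sets \<mu> = sets \<nu> \<and> absolutely_continuous \<mu> \<nu> \<and> absolutely_continuous \<nu> \<mu>"

definition class_of_measure :: "'a measure \<Rightarrow> 'a measure set" where
  "class_of_measure \<mu> = {\<nu>. sigma_finite_measure \<nu> \<and> equivalent_measures \<mu> \<nu>}"

definition measure_class :: "'a measure \<Rightarrow> 'a measure set \<Rightarrow> bool" where
  "measure_class M C \<longleftrightarrow>
     (\<exists>\<mu>. sigma_finite_measure \<mu> \<and> sets \<mu> = sets M \<and> C = class_of_measure \<mu>)"

definition AE_class :: "'a measure set \<Rightarrow> ('a \<Rightarrow> bool) \<Rightarrow> bool" where
  "AE_class C P \<longleftrightarrow> (\<forall>\<mu>\<in>C. AE x in \<mu>. P x)"


section \<open>Measured groupoids\<close>

text \<open>The unit space is the subset \<open>rng G ` space (arrows G)\<close> of the groupoid, with the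
  induced Borel structure. The product \<open>\<gamma> \<cdot>\<^bsub>G\<^esub> \<eta>\<close> is meaningful when \<open>src G \<gamma> = rng G \<eta>\<close>.\<close>

record 'g groupoid =
  arrows :: "'g measure"
  rng :: "'g \<Rightarrow> 'g"
  src :: "'g \<Rightarrow> 'g"
  gmult :: "'g \<Rightarrow> 'g \<Rightarrow> 'g" (infixl \<open>\<cdot>\<index>\<close> 70)
  ginv :: "'g \<Rightarrow> 'g"

definition unit_space :: "'g groupoid \<Rightarrow> 'g measure" where
  "unit_space G = restrict_space (arrows G) (rng G ` space (arrows G))"

locale groupoid =
  fixes G :: "'g groupoid" (structure)
  assumes rng_closed: "\<gamma> \<in> space (arrows G) \<Longrightarrow> rng G \<gamma> \<in> space (arrows G)"
    and src_closed: "\<gamma> \<in> space (arrows G) \<Longrightarrow> src G \<gamma> \<in> space (arrows G)"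
    and rng_rng: "\<gamma> \<in> space (arrows G) \<Longrightarrow> rng G (rng G \<gamma>) = rng G \<gamma>"
    and src_rng: "\<gamma> \<in> space (arrows G) \<Longrightarrow> src G (rng G \<gamma>) = rng G \<gamma>"
    and rng_src: "\<gamma> \<in> space (arrows G) \<Longrightarrow> rng G (src G \<gamma>) = src G \<gamma>"
    and src_src: "\<gamma> \<in> space (arrows G) \<Longrightarrow> src G (src G \<gamma>) = src G \<gamma>"
    and mult_closed: "\<lbrakk>\<gamma> \<in> space (arrows G); \<eta> \<in> space (arrows G); src G \<gamma> = rng G \<eta>\<rbrakk>
          \<Longrightarrow> \<gamma> \<cdot> \<eta> \<in> space (arrows G)"
    and rng_mult: "\<lbrakk>\<gamma> \<in> space (arrows G); \<eta> \<in> space (arrows G); src G \<gamma> = rng G \<eta>\<rbrakk>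
          \<Longrightarrow> rng G (\<gamma> \<cdot> \<eta>) = rng G \<gamma>"
    and src_mult: "\<lbrakk>\<gamma> \<in> space (arrows G); \<eta> \<in> space (arrows G); src G \<gamma> = rng G \<eta>\<rbrakk>
          \<Longrightarrow> src G (\<gamma> \<cdot> \<eta>) = src G \<eta>"
    and mult_assoc: "\<lbrakk>\<gamma> \<in> space (arrows G); \<eta> \<in> space (arrows G); \<zeta> \<in> space (arrows G);
            src G \<gamma> = rng G \<eta>; src G \<eta> = rng G \<zeta>\<rbrakk>
          \<Longrightarrow> (\<gamma> \<cdot> \<eta>) \<cdot> \<zeta> = \<gamma> \<cdot> (\<eta> \<cdot> \<zeta>)"
    and unit_left: "\<gamma> \<in> space (arrows G) \<Longrightarrow> rng G \<gamma> \<cdot> \<gamma> = \<gamma>"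
    and unit_right: "\<gamma> \<in> space (arrows G) \<Longrightarrow> \<gamma> \<cdot> src G \<gamma> = \<gamma>"
    and inv_closed: "\<gamma> \<in> space (arrows G) \<Longrightarrow> ginv G \<gamma> \<in> space (arrows G)"
    and rng_inv: "\<gamma> \<in> space (arrows G) \<Longrightarrow> rng G (ginv G \<gamma>) = src G \<gamma>"
    and src_inv: "\<gamma> \<in> space (arrows G) \<Longrightarrow> src G (ginv G \<gamma>) = rng G \<gamma>"
    and inv_right: "\<gamma> \<in> space (arrows G) \<Longrightarrow> \<gamma> \<cdot> ginv G \<gamma> = rng G \<gamma>"
    and inv_left: "\<gamma> \<in> space (arrows G) \<Longrightarrow> ginv G \<gamma> \<cdot> \<gamma> = src G \<gamma>"

locale borel_groupoid = groupoid +
  assumes standard: "standard_borel (arrows G)"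
    and rng_measurable: "rng G \<in> arrows G \<rightarrow>\<^sub>M arrows G"
    and src_measurable: "src G \<in> arrows G \<rightarrow>\<^sub>M arrows G"
    and inv_measurable: "ginv G \<in> arrows G \<rightarrow>\<^sub>M arrows G"
    and mult_measurable: "(\<lambda>(\<gamma>, \<eta>). \<gamma> \<cdot> \<eta>) \<in>
          restrict_space (arrows G \<Otimes>\<^sub>M arrows G) {(\<gamma>, \<eta>). src G \<gamma> = rng G \<eta>} \<rightarrow>\<^sub>M arrows G"

text \<open>The class \<open>r(C)\<close> on the unit space.\<close>

definition unit_class :: "'g groupoid \<Rightarrow> 'g measure set \<Rightarrow> 'g measure set" where
  "unit_class G C =
     (\<Union>\<nu>\<in>{\<nu>\<in>C. prob_space \<nu>}. class_of_measure (distr \<nu> (unit_space G) (rng G)))"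

definition conull_borel :: "'g groupoid \<Rightarrow> 'g measure set \<Rightarrow> 'g set \<Rightarrow> bool" where
  "conull_borel G C U \<longleftrightarrow> U \<in> sets (unit_space G) \<and> AE_class (unit_class G C) (\<lambda>x. x \<in> U)"

definition null_borel :: "'g groupoid \<Rightarrow> 'g measure set \<Rightarrow> 'g set \<Rightarrow> bool" where
  "null_borel G C A \<longleftrightarrow> A \<in> sets (unit_space G) \<and> AE_class (unit_class G C) (\<lambda>x. x \<notin> A)"

definition reduction :: "'g groupoid \<Rightarrow> 'g set \<Rightarrow> 'g set" where
  "reduction G U = {\<gamma> \<in> space (arrows G). rng G \<gamma> \<in> U \<and> src G \<gamma> \<in> U}"

definition symmetric_class :: "'g groupoid \<Rightarrow> 'g measure set \<Rightarrow> bool" where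
  "symmetric_class G C \<longleftrightarrow> (\<forall>\<nu>\<in>C. equivalent_measures \<nu> (distr \<nu> (arrows G) (ginv G)))"

text \<open>The disintegration of a probability measure consists of probability measures, up to
  modification on a null set of units.\<close>

definition disintegration :: "'g groupoid \<Rightarrow> 'g measure \<Rightarrow> ('g \<Rightarrow> 'g measure) \<Rightarrow> bool" where
  "disintegration G \<nu> \<kappa> \<longleftrightarrow>
     \<kappa> \<in> unit_space G \<rightarrow>\<^sub>M prob_algebra (arrows G) \<and>
     (AE x in distr \<nu> (unit_space G) (rng G). AE \<gamma> in \<kappa> x. rng G \<gamma> = x) \<and>
     (\<forall>B\<in>sets (arrows G).
        emeasure \<nu> B = (\<integral>\<^sup>+x. emeasure (\<kappa> x) B \<partial>distr \<nu> (unit_space G) (rng G)))"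

text \<open>For a measure \<open>\<mu>\<close> carried by the fibre \<open>r\<inverse>(s(\<gamma>))\<close>, its image \<open>\<gamma>\<mu>\<close> under left
  multiplication by \<open>\<gamma>\<close>.\<close>

definition left_translate :: "'g groupoid \<Rightarrow> 'g \<Rightarrow> 'g measure \<Rightarrow> 'g measure" where
  "left_translate G \<gamma> \<mu> =
     distr (restrict_space \<mu> {\<eta> \<in> space (arrows G). rng G \<eta> = src G \<gamma>}) (arrows G)
       (\<lambda>\<eta>. \<gamma> \<cdot>\<^bsub>G\<^esub> \<eta>)"

text \<open>Quasi-invariance ``for almost every \<open>\<gamma>\<close>'' is taken in Ramsay's sense: it holds for all
  \<open>\<gamma>\<close> in an inessential reduction. Asking for it only outside a \<open>C\<close>-null set is too weak: on
  the discrete group \<open>SL(3, Z)\<close>, the class of a probability measure whose support is an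
  infinite cyclic subgroup would qualify, although it ignores the rest of the group. For that
  class all cohomology vanishes, but the regular representation almost contains unit invariant
  sections and contains none.\<close>

definition invariant_class :: "'g groupoid \<Rightarrow> 'g measure set \<Rightarrow> bool" where
  "invariant_class G C \<longleftrightarrow>
     (\<exists>\<nu>\<in>C. prob_space \<nu> \<and>
        (\<exists>\<kappa>. disintegration G \<nu> \<kappa> \<and>
           (\<exists>U. conull_borel G C U \<and>
              (\<forall>\<gamma>\<in>reduction G U.
                 equivalent_measures (left_translate G \<gamma> (\<kappa> (src G \<gamma>))) (\<kappa> (rng G \<gamma>))))))"

definition measured_groupoid :: "'g groupoid \<Rightarrow> 'g measure set \<Rightarrow> bool" where
  "measured_groupoid G C \<longleftrightarrow>
     borel_groupoid G \<and> measure_class (arrows G) C \<and> symmetric_class G C \<and> invariant_class G C"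

definition invariant_set :: "'g groupoid \<Rightarrow> 'g set \<Rightarrow> bool" where
  "invariant_set G A \<longleftrightarrow> src G ` {\<gamma> \<in> space (arrows G). rng G \<gamma> \<in> A} = A"

definition ergodic :: "'g groupoid \<Rightarrow> 'g measure set \<Rightarrow> bool" where
  "ergodic G C \<longleftrightarrow>
     (\<forall>A\<in>sets (unit_space G). invariant_set G A \<longrightarrow> null_borel G C A \<or> conull_borel G C A)"


section \<open>Hilbert spaces and Hilbert bundles\<close>

text \<open>The fibres of a bundle vary with the base point, so Hilbert spaces are structures on
  carrier sets: modules over the field of complex numbers with an inner product, linear in
  the first argument. (The ring multiplication inherited from the record of modules plays
  no role.)\<close>

definition complex_field :: "complex ring" where
  "complex_field = \<lparr>carrier = UNIV, monoid.mult = (*), one = 1, zero = 0, add = (+)\<rparr>"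

record 'h hilbert = "(complex, 'h) module" +
  hinner :: "'h \<Rightarrow> 'h \<Rightarrow> complex"

definition hnorm :: "'h hilbert \<Rightarrow> 'h \<Rightarrow> real" where
  "hnorm H v = sqrt (Re (hinner H v v))"

locale complex_hilbert_space = Module.module complex_field H for H :: "'h hilbert" (structure) +
  assumes inner_add: "\<lbrakk>u \<in> carrier H; v \<in> carrier H; w \<in> carrier H\<rbrakk>
          \<Longrightarrow> hinner H (u \<oplus> v) w = hinner H u w + hinner H v w"
    and inner_smult: "\<lbrakk>v \<in> carrier H; w \<in> carrier H\<rbrakk>
          \<Longrightarrow> hinner H (c \<odot> v) w = c * hinner H v w"
    and inner_cnj: "\<lbrakk>v \<in> carrier H; w \<in> carrier H\<rbrakk> \<Longrightarrow> hinner H w v = cnj (hinner H v w)"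
    and inner_nonneg: "v \<in> carrier H \<Longrightarrow> 0 \<le> Re (hinner H v v)"
    and inner_definite: "\<lbrakk>v \<in> carrier H; hinner H v v = 0\<rbrakk> \<Longrightarrow> v = \<zero>"
    and complete: "\<lbrakk>\<And>n. f n \<in> carrier H;
            \<And>\<epsilon>. \<epsilon> > 0 \<Longrightarrow> \<exists>N. \<forall>m\<ge>N. \<forall>n\<ge>N. hnorm H (f m \<ominus> f n) < \<epsilon>\<rbrakk>
          \<Longrightarrow> \<exists>v\<in>carrier H. (\<lambda>n. hnorm H (f n \<ominus> v)) \<longlonglongrightarrow> 0"

definition total_sequence :: "'h hilbert \<Rightarrow> (nat \<Rightarrow> 'h) \<Rightarrow> bool" where
  "total_sequence H w \<longleftrightarrow>
     (\<forall>n. w n \<in> carrier H) \<and>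
     (\<forall>v\<in>carrier H. \<forall>\<epsilon>>0. \<exists>n c.
        hnorm H (v \<ominus>\<^bsub>H\<^esub> (\<Oplus>\<^bsub>H\<^esub>i\<in>{..<n}. c i \<odot>\<^bsub>H\<^esub> w i)) < \<epsilon>)"

definition hilbert_isomorphism :: "'h hilbert \<Rightarrow> 'h hilbert \<Rightarrow> ('h \<Rightarrow> 'h) \<Rightarrow> bool" where
  "hilbert_isomorphism H K T \<longleftrightarrow>
     bij_betw T (carrier H) (carrier K) \<and>
     (\<forall>v\<in>carrier H. \<forall>w\<in>carrier H. T (v \<oplus>\<^bsub>H\<^esub> w) = T v \<oplus>\<^bsub>K\<^esub> T w) \<and>
     (\<forall>c. \<forall>v\<in>carrier H. T (c \<odot>\<^bsub>H\<^esub> v) = c \<odot>\<^bsub>K\<^esub> T v) \<and>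
     (\<forall>v\<in>carrier H. \<forall>w\<in>carrier H. hinner K (T v) (T w) = hinner H v w)"

text \<open>The Borel structure of a bundle is given by a fundamental sequence of sections, total in
  every fibre (which makes the fibres separable).\<close>

record ('x, 'h) bundle_data =
  fibre :: "'x \<Rightarrow> 'h hilbert"
  fund :: "nat \<Rightarrow> 'x \<Rightarrow> 'h"

definition hilbert_bundle :: "'x measure \<Rightarrow> ('x, 'h) bundle_data \<Rightarrow> bool" where
  "hilbert_bundle X \<H> \<longleftrightarrow>
     (\<forall>x\<in>space X. complex_hilbert_space (fibre \<H> x) \<and>
        total_sequence (fibre \<H> x) (\<lambda>n. fund \<H> n x)) \<and>
     (\<forall>m n. (\<lambda>x. hinner (fibre \<H> x) (fund \<H> m x) (fund \<H> n x)) \<in> borel_measurable X)"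

definition borel_sections :: "'x measure \<Rightarrow> ('x, 'h) bundle_data \<Rightarrow> ('x \<Rightarrow> 'h) set" where
  "borel_sections X \<H> =
     {\<xi>. (\<forall>x\<in>space X. \<xi> x \<in> carrier (fibre \<H> x)) \<and>
         (\<forall>n. (\<lambda>x. hinner (fibre \<H> x) (\<xi> x) (fund \<H> n x)) \<in> borel_measurable X)}"

definition pullback :: "('y \<Rightarrow> 'x) \<Rightarrow> ('x, 'h) bundle_data \<Rightarrow> ('y, 'h) bundle_data" where
  "pullback f \<H> = \<lparr>fibre = (\<lambda>y. fibre \<H> (f y)), fund = (\<lambda>n y. fund \<H> n (f y))\<rparr>"


section \<open>Representations and cohomology\<close>

text \<open>A family of operators \<open>L(\<gamma>)\<close> is Borel if it carries Borel sections of the bundle to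
  Borel sections of its pullback along the range map, that is, if all coefficients
  \<open>\<gamma> \<mapsto> \<langle>L(\<gamma>) \<xi>(s(\<gamma>)), \<xi>'(r(\<gamma>))\<rangle>\<close> are Borel.\<close>

definition representation ::
    "'g groupoid \<Rightarrow> 'g measure set \<Rightarrow> ('g, 'h) bundle_data \<Rightarrow> ('g \<Rightarrow> 'h \<Rightarrow> 'h) \<Rightarrow> bool" where
  "representation G C \<H> L \<longleftrightarrow>
     (\<forall>\<gamma>\<in>space (arrows G).
        hilbert_isomorphism (fibre \<H> (src G \<gamma>)) (fibre \<H> (rng G \<gamma>)) (L \<gamma>)) \<and>
     (\<forall>\<xi>\<in>borel_sections (unit_space G) \<H>.
        (\<lambda>\<gamma>. L \<gamma> (\<xi> (src G \<gamma>))) \<in> borel_sections (arrows G) (pullback (rng G) \<H>)) \<and>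
     (\<exists>U. conull_borel G C U \<and>
        (\<forall>\<gamma>\<in>reduction G U. \<forall>\<eta>\<in>reduction G U. src G \<gamma> = rng G \<eta> \<longrightarrow>
           (\<forall>v\<in>carrier (fibre \<H> (src G \<eta>)). L (\<gamma> \<cdot>\<^bsub>G\<^esub> \<eta>) v = L \<gamma> (L \<eta> v))))"

definition cocycles ::
    "'g groupoid \<Rightarrow> 'g measure set \<Rightarrow> ('g, 'h) bundle_data \<Rightarrow> ('g \<Rightarrow> 'h \<Rightarrow> 'h) \<Rightarrow> ('g \<Rightarrow> 'h) set" where
  "cocycles G C \<H> L =
     {b \<in> borel_sections (arrows G) (pullback (rng G) \<H>).
        \<exists>U. conull_borel G C U \<and>
          (\<forall>\<gamma>\<in>reduction G U. \<forall>\<eta>\<in>reduction G U. src G \<gamma> = rng G \<eta> \<longrightarrow>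
             b (\<gamma> \<cdot>\<^bsub>G\<^esub> \<eta>) = b \<gamma> \<oplus>\<^bsub>fibre \<H> (rng G \<gamma>)\<^esub> L \<gamma> (b \<eta>))}"

definition coboundary ::
    "'g groupoid \<Rightarrow> 'g measure set \<Rightarrow> ('g, 'h) bundle_data \<Rightarrow> ('g \<Rightarrow> 'h \<Rightarrow> 'h) \<Rightarrow> ('g \<Rightarrow> 'h) \<Rightarrow> bool" where
  "coboundary G C \<H> L b \<longleftrightarrow>
     (\<exists>\<xi>\<in>borel_sections (unit_space G) \<H>.
        AE_class C (\<lambda>\<gamma>. b \<gamma> = \<xi> (rng G \<gamma>) \<ominus>\<^bsub>fibre \<H> (rng G \<gamma>)\<^esub> L \<gamma> (\<xi> (src G \<gamma>))))"

text \<open>Being a coboundary is insensitive to changes on a \<open>C\<close>-null set, so the two successive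
  quotients (by equality almost everywhere, then by the coboundaries) are one quotient, by
  the relation ``the difference is a coboundary''.\<close>

definition cohomologous ::
    "'g groupoid \<Rightarrow> 'g measure set \<Rightarrow> ('g, 'h) bundle_data \<Rightarrow> ('g \<Rightarrow> 'h \<Rightarrow> 'h) \<Rightarrow>
       (('g \<Rightarrow> 'h) \<times> ('g \<Rightarrow> 'h)) set" where
  "cohomologous G C \<H> L =
     {(b, b'). b \<in> cocycles G C \<H> L \<and> b' \<in> cocycles G C \<H> L \<and>
        coboundary G C \<H> L (\<lambda>\<gamma>. b \<gamma> \<ominus>\<^bsub>fibre \<H> (rng G \<gamma>)\<^esub> b' \<gamma>)}"

definition H1 ::
    "'g groupoid \<Rightarrow> 'g measure set \<Rightarrow> ('g, 'h) bundle_data \<Rightarrow> ('g \<Rightarrow> 'h \<Rightarrow> 'h) \<Rightarrow> ('g \<Rightarrow> 'h) set set" where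
  "H1 G C \<H> L = cocycles G C \<H> L // cohomologous G C \<H> L"

definition H1_zero ::
    "'g groupoid \<Rightarrow> 'g measure set \<Rightarrow> ('g, 'h) bundle_data \<Rightarrow> ('g \<Rightarrow> 'h \<Rightarrow> 'h) \<Rightarrow> ('g \<Rightarrow> 'h) set" where
  "H1_zero G C \<H> L = cohomologous G C \<H> L `` {\<lambda>\<gamma>. \<zero>\<^bsub>fibre \<H> (rng G \<gamma>)\<^esub>}"


section \<open>Property T\<close>

definition unit_section ::
    "'g groupoid \<Rightarrow> 'g measure set \<Rightarrow> ('g, 'h) bundle_data \<Rightarrow> ('g \<Rightarrow> 'h) \<Rightarrow> bool" where
  "unit_section G C \<H> \<xi> \<longleftrightarrow>
     \<xi> \<in> borel_sections (unit_space G) \<H> \<and>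
     AE_class (unit_class G C) (\<lambda>x. hnorm (fibre \<H> x) (\<xi> x) = 1)"

definition almost_contains_unit_invariant_sections ::
    "'g groupoid \<Rightarrow> 'g measure set \<Rightarrow> ('g, 'h) bundle_data \<Rightarrow> ('g \<Rightarrow> 'h \<Rightarrow> 'h) \<Rightarrow> bool" where
  "almost_contains_unit_invariant_sections G C \<H> L \<longleftrightarrow>
     (\<exists>\<xi>. (\<forall>n. unit_section G C \<H> (\<xi> n)) \<and>
        AE_class C (\<lambda>\<gamma>.
          (\<lambda>n. hnorm (fibre \<H> (rng G \<gamma>))
                 (\<xi> n (rng G \<gamma>) \<ominus>\<^bsub>fibre \<H> (rng G \<gamma>)\<^esub> L \<gamma> (\<xi> n (src G \<gamma>)))) \<longlonglongrightarrow> 0))"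

definition contains_unit_invariant_section ::
    "'g groupoid \<Rightarrow> 'g measure set \<Rightarrow> ('g, 'h) bundle_data \<Rightarrow> ('g \<Rightarrow> 'h \<Rightarrow> 'h) \<Rightarrow> bool" where
  "contains_unit_invariant_section G C \<H> L \<longleftrightarrow>
     (\<exists>\<xi>. unit_section G C \<H> \<xi> \<and>
        AE_class C (\<lambda>\<gamma>. \<xi> (rng G \<gamma>) = L \<gamma> (\<xi> (src G \<gamma>))))"

text \<open>Bundles range over a fixed type of vectors. This loses no generality: if \<open>(\<xi>\<^sub>n)\<close> is the
  fundamental sequence of a bundle with fibres in any type, then \<open>v \<mapsto> (\<langle>v, \<xi>\<^sub>n(x)\<rangle>)\<^sub>n\<close> is
  injective on the fibre over \<open>x\<close>, so its structure can be transported to a set of complex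
  sequences.\<close>

type_synonym vec = "nat \<Rightarrow> complex"

definition property_T :: "'g groupoid \<Rightarrow> 'g measure set \<Rightarrow> bool" where
  "property_T G C \<longleftrightarrow>
     (\<forall>(\<H> :: ('g, vec) bundle_data) L.
        hilbert_bundle (unit_space G) \<H> \<and> representation G C \<H> L \<and>
        almost_contains_unit_invariant_sections G C \<H> L \<longrightarrow>
        contains_unit_invariant_section G C \<H> L)"

end

theory Submission
  imports Defs
begin

text \<open>Given almost invariant unit sections \<open>\<xi>\<^sub>k\<close>, pass to a subsequence such that the squared norms
  of the coboundaries \<open>\<delta>\<xi>\<^sub>k(\<gamma>) = \<xi>\<^sub>k(r(\<gamma>)) - L(\<gamma>)\<xi>\<^sub>k(s(\<gamma>))\<close> are summable for almost every \<open>\<gamma>\<close>.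
  By quasi-invariance they are then summable for every \<open>\<gamma>\<close> in an inessential reduction, so that
  \<open>b = (\<delta>\<xi>\<^sub>k)\<^sub>k\<close> is a cocycle for the \<open>\<ell>\<^sup>2\<close>-sum of countably many copies of \<open>L\<close>. As \<open>- b\<close> is the
  coboundary of some \<open>\<eta> = (\<eta>\<^sub>k)\<^sub>k\<close>, the sections \<open>\<zeta>\<^sub>k = \<xi>\<^sub>k + \<eta>\<^sub>k\<close> are invariant. They cannot all vanish
  at a unit, because \<open>\<parallel>\<xi>\<^sub>k\<parallel> = 1\<close> while \<open>\<parallel>\<eta>\<^sub>k\<parallel> \<rightarrow> 0\<close>, and the first nonvanishing one, normalised, is a
  unit invariant section.\<close>

section \<open>Hilbert spaces on carrier sets\<close>

text \<open>A single coboundary of \<open>\<xi>\<^sub>k\<close> carries no information in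
  cohomology. The sequence does: the vectors \<open>\<xi>\<^sub>k(x)\<close> have norm one and are
  not square-summable, so \<open>b\<close> is only formally the coboundary of
  \<open>(\<xi>\<^sub>k)\<^sub>k\<close>. A square-summable primitive of it must therefore differ
  from this formal one, and the difference is exactly invariant. The obstacle is the step from
  almost every arrow to all arrows of an inessential reduction: a cocycle takes values in the fibre
  over every arrow and satisfies its identity on every composable pair of such a reduction, and a
  conull set of arrows need not contain one. What helps is that summability passes from
  \<gamma>\<eta> and \<eta> to \<gamma>, because the coboundary at \<gamma> is the one at
  \<gamma>\<eta> minus the L(\<gamma>)-image of the one at \<eta>, and L(\<gamma>) is
  isometric.\<close>

lemma complex_field_simps [simp]:
  "carrier complex_field = UNIV" "one complex_field = 1" "zero complex_field = 0"
  "monoid.mult complex_field = (*)" "add complex_field = (+)"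
  by (simp_all add: complex_field_def)

lemma cring_complex_field: "cring complex_field"
proof (rule cringI)
  show "abelian_group complex_field"
    by (rule abelian_groupI) (auto intro: exI[of _ "- x" for x] simp: algebra_simps add_eq_0_iff)
  show "comm_monoid complex_field"
    by unfold_locales (auto simp: algebra_simps)
qed (auto simp: algebra_simps)

lemma hnorm_nonneg [simp]: "complex_hilbert_space H \<Longrightarrow> v \<in> carrier H \<Longrightarrow> 0 \<le> hnorm H v"
  by (simp add: hnorm_def complex_hilbert_space.inner_nonneg)

context complex_hilbert_space
begin

lemma smult_in [simp, intro]: "v \<in> carrier H \<Longrightarrow> c \<odot> v \<in> carrier H"
  using smult_closed by simp

lemma smult_0 [simp]: "v \<in> carrier H \<Longrightarrow> 0 \<odot> v = \<zero>"
  using smult_l_null by simp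

lemma smult_1 [simp]: "v \<in> carrier H \<Longrightarrow> 1 \<odot> v = v"
  using smult_one by simp

lemma smult_add_left: "v \<in> carrier H \<Longrightarrow> (a + b) \<odot> v = a \<odot> v \<oplus> b \<odot> v"
  using smult_l_distr by simp

lemma smult_smult: "v \<in> carrier H \<Longrightarrow> (a * b) \<odot> v = a \<odot> (b \<odot> v)"
  using smult_assoc1 by simp

lemma smult_minus_one: "v \<in> carrier H \<Longrightarrow> (- 1) \<odot> v = \<ominus> v"
  using smult_add_left[of v "- 1" 1] minus_equality[of "(- 1) \<odot> v" v] by simp

lemma inner_zero_left [simp]: "w \<in> carrier H \<Longrightarrow> hinner H \<zero> w = 0"
  using inner_smult[of \<zero> w 0] by simp

lemma inner_zero_right [simp]: "w \<in> carrier H \<Longrightarrow> hinner H w \<zero> = 0"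
  using inner_cnj[of \<zero> w] by simp

lemma inner_minus: 
  assumes "u \<in> carrier H" "v \<in> carrier H" "w \<in> carrier H"
  shows "hinner H (u \<ominus> v) w = hinner H u w - hinner H v w"
  using assms by (simp add: a_minus_def inner_add flip: smult_minus_one) (simp add: inner_smult)

lemma inner_add_right:
  assumes "u \<in> carrier H" "v \<in> carrier H" "w \<in> carrier H"
  shows "hinner H w (u \<oplus> v) = hinner H w u + hinner H w v"
  using assms by (metis inner_cnj inner_add add.m_closed complex_cnj_add)

lemma inner_minus_right:
  assumes "u \<in> carrier H" "v \<in> carrier H" "w \<in> carrier H"
  shows "hinner H w (u \<ominus> v) = hinner H w u - hinner H w v"
  using assms by (metis inner_cnj inner_minus minus_closed complex_cnj_diff)

lemma inner_smult_right:
  assumes "v \<in> carrier H" "w \<in> carrier H"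
  shows "hinner H w (c \<odot> v) = cnj c * hinner H w v"
  using assms by (metis inner_cnj inner_smult smult_in complex_cnj_mult)

lemma hnorm_sq: "v \<in> carrier H \<Longrightarrow> (hnorm H v)\<^sup>2 = Re (hinner H v v)"
  by (simp add: hnorm_def inner_nonneg)

lemma inner_self: "v \<in> carrier H \<Longrightarrow> hinner H v v = of_real ((hnorm H v)\<^sup>2)"
  using inner_cnj[of v v] by (simp add: hnorm_sq complex_eq_iff)

lemma hnorm_eq_0_iff [simp]: "v \<in> carrier H \<Longrightarrow> hnorm H v = 0 \<longleftrightarrow> v = \<zero>"
  by (metis inner_definite inner_self inner_zero_left of_real_0 of_real_eq_0_iff zero_eq_power2)

lemma hnorm_zero [simp]: "hnorm H \<zero> = 0"
  by simp

lemma hnorm_smult: "v \<in> carrier H \<Longrightarrow> hnorm H (c \<odot> v) = cmod c * hnorm H v"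
proof -
  assume v: "v \<in> carrier H"
  have "(hnorm H (c \<odot> v))\<^sup>2 = (cmod c * hnorm H v)\<^sup>2"
    using v by (simp add: hnorm_sq inner_smult inner_smult_right power_mult_distrib
        cmod_power2 algebra_simps) (simp add: inner_self power2_eq_square algebra_simps)
  thus ?thesis using v by (simp add: complex_hilbert_space_axioms)
qed

lemma hnorm_add_sq: 
  assumes "u \<in> carrier H" "v \<in> carrier H"
  shows "(hnorm H (u \<oplus> v))\<^sup>2 = (hnorm H u)\<^sup>2 + (hnorm H v)\<^sup>2 + 2 * Re (hinner H u v)"
  using assms inner_cnj[of u v] by (simp add: hnorm_sq inner_add inner_add_right)

lemma hnorm_minus_sq: 
  assumes "u \<in> carrier H" "v \<in> carrier H"
  shows "(hnorm H (u \<ominus> v))\<^sup>2 = (hnorm H u)\<^sup>2 + (hnorm H v)\<^sup>2 - 2 * Re (hinner H u v)"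
  using assms inner_cnj[of u v] by (simp add: hnorm_sq inner_minus inner_minus_right)

text \<open>The parallelogram identity with one square dropped. This replaces the triangle
  inequality throughout, since every summability condition here concerns squares of norms.\<close>

lemma hnorm_minus_sq_le: 
  assumes "u \<in> carrier H" "v \<in> carrier H"
  shows "(hnorm H (u \<ominus> v))\<^sup>2 \<le> 2 * (hnorm H u)\<^sup>2 + 2 * (hnorm H v)\<^sup>2"
  using hnorm_add_sq[OF assms] hnorm_minus_sq[OF assms] zero_le_power2[of "hnorm H (u \<oplus> v)"]
  by linarith

lemma hnorm_add_sq_le: 
  assumes "u \<in> carrier H" "v \<in> carrier H"
  shows "(hnorm H (u \<oplus> v))\<^sup>2 \<le> 2 * (hnorm H u)\<^sup>2 + 2 * (hnorm H v)\<^sup>2"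
  using hnorm_add_sq[OF assms] hnorm_minus_sq[OF assms] zero_le_power2[of "hnorm H (u \<ominus> v)"]
  by linarith

lemma minus_via:
  assumes "u \<in> carrier H" "v \<in> carrier H" "w \<in> carrier H"
  shows "u \<ominus> w = (u \<ominus> v) \<oplus> (v \<ominus> w)"
proof -
  have "\<ominus> v \<oplus> (v \<oplus> \<ominus> w) = \<ominus> w"
    using assms by (simp flip: a_assoc add: l_neg)
  thus ?thesis using assms by (simp add: a_minus_def a_assoc)
qed

lemma hnorm_dist_sq_le: 
  assumes "u \<in> carrier H" "v \<in> carrier H" "w \<in> carrier H"
  shows "(hnorm H (u \<ominus> w))\<^sup>2 \<le> 2 * (hnorm H (u \<ominus> v))\<^sup>2 + 2 * (hnorm H (v \<ominus> w))\<^sup>2"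
  using assms minus_via[OF assms] hnorm_add_sq_le[of "u \<ominus> v" "v \<ominus> w"] by simp

text \<open>An additive form of the Cauchy-Schwarz inequality; it bounds a series of inner products
  by two series of squared norms, which is what the inner product of \<open>ell2\<close>
  requires.\<close>

lemma cmod_inner_le:
  assumes "u \<in> carrier H" "v \<in> carrier H"
  shows "2 * cmod (hinner H u v) \<le> (hnorm H u)\<^sup>2 + (hnorm H v)\<^sup>2"
proof (cases "hinner H u v = 0")
  case False
  \<comment> \<open>A phase that rotates the inner product onto its modulus; the bound is then the
    expansion of the squared norm of \<open>c \<odot> u \<ominus> v\<close>, which is
    nonnegative.\<close>
  define c where "c = cnj (hinner H u v) / cmod (hinner H u v)"
  have c: "cmod c = 1" using False by (simp add: c_def norm_divide)
  have "c * hinner H u v = of_real (cmod (hinner H u v))"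
    using False by (simp add: c_def mult.commute[of "cnj _"] complex_norm_square power2_eq_square)
      (simp add: field_simps flip: complex_norm_square power2_eq_square of_real_mult)
  hence "Re (hinner H (c \<odot> u) v) = cmod (hinner H u v)"
    using assms by (simp add: inner_smult)
  thus ?thesis
    using hnorm_minus_sq[of "c \<odot> u" v] assms c zero_le_power2[of "hnorm H (c \<odot> u \<ominus> v)"]
    by (simp add: hnorm_smult)
qed simp

lemma minus_eq_0_iff: "u \<in> carrier H \<Longrightarrow> v \<in> carrier H \<Longrightarrow> u \<ominus> v = \<zero> \<longleftrightarrow> u = v"
  using hnorm_eq_0_iff[of "u \<ominus> v"] minus_equality[of u "\<ominus> v"] by (auto simp: a_minus_def r_neg)

end

subsection \<open>Linear combinations and total sequences\<close>

definition lincomb :: "'h hilbert \<Rightarrow> (nat \<Rightarrow> 'h) \<Rightarrow> (nat \<Rightarrow> complex) \<Rightarrow> nat \<Rightarrow> 'h" where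
  "lincomb H w c n = (\<Oplus>\<^bsub>H\<^esub>i\<in>{..<n}. c i \<odot>\<^bsub>H\<^esub> w i)"

definition lin_span :: "'h hilbert \<Rightarrow> (nat \<Rightarrow> 'h) \<Rightarrow> 'h set" where
  "lin_span H w = {lincomb H w c n |c n. True}"

context complex_hilbert_space
begin

context
  fixes w :: "nat \<Rightarrow> 'h"
  assumes w: "\<And>i. w i \<in> carrier H"
begin

lemma lincomb_0 [simp]: "lincomb H w c 0 = \<zero>"
  by (simp add: lincomb_def)

lemma lincomb_closed [simp, intro]: "lincomb H w c n \<in> carrier H"
  unfolding lincomb_def using w by (intro finsum_closed) auto

lemma lincomb_Suc: "lincomb H w c (Suc n) = c n \<odot> w n \<oplus> lincomb H w c n"
  unfolding lincomb_def lessThan_Suc using w by (subst finsum_insert) auto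

lemma lincomb_cong: "(\<And>i. i < n \<Longrightarrow> c i = d i) \<Longrightarrow> lincomb H w c n = lincomb H w d n"
  by (induction n) (simp_all add: lincomb_Suc)

text \<open>Zero coefficients bring two combinations to a common length, so that they can be added
  termwise; this makes \<open>lin_span\<close> closed under sums.\<close>

lemma lincomb_pad: "n \<le> m \<Longrightarrow> lincomb H w (\<lambda>i. if i < n then c i else 0) m = lincomb H w c n"
proof (induction m rule: dec_induct)
  case base
  show ?case by (rule lincomb_cong) simp
qed (simp add: lincomb_Suc w)

lemma lincomb_add: "lincomb H w (\<lambda>i. c i + d i) n = lincomb H w c n \<oplus> lincomb H w d n"
  by (induction n) (use w in \<open>simp_all add: lincomb_Suc smult_add_left a_ac\<close>)

lemma inner_lincomb:
  "v \<in> carrier H \<Longrightarrow> hinner H (lincomb H w c n) v = (\<Sum>i<n. c i * hinner H (w i) v)"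
  by (induction n) (use w in \<open>simp_all add: lincomb_Suc inner_add inner_smult\<close>)

lemma lin_span_closed: "lin_span H w \<subseteq> carrier H"
  by (auto simp: lin_span_def)

lemma lin_span_zero: "\<zero> \<in> lin_span H w"
  unfolding lin_span_def using lincomb_0[of undefined, symmetric] by blast

lemma lin_span_add:
  assumes "u \<in> lin_span H w" "v \<in> lin_span H w"
  shows "u \<oplus> v \<in> lin_span H w"
proof -
  obtain c n d m where u: "u = lincomb H w c n" and v: "v = lincomb H w d m"
    using assms by (auto simp: lin_span_def)
  have "u \<oplus> v = lincomb H w (\<lambda>i. (if i < n then c i else 0) + (if i < m then d i else 0)) (max n m)"
    by (simp only: lincomb_add u v lincomb_pad max.cobounded1 max.cobounded2)
  thus ?thesis by (auto simp: lin_span_def)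
qed

lemma lin_span_smult: "a \<odot> w i \<in> lin_span H w"
proof -
  let ?c = "\<lambda>j. if j < i then 0 else a"
  \<comment> \<open>Below \<open>i\<close> all coefficients of \<open>?c\<close> vanish. The
    right-hand side is phrased as a padding of the empty combination, so \<open>lincomb_pad\<close>
    shows that it is zero.\<close>
  have "lincomb H w ?c i = lincomb H w (\<lambda>j. if j < 0 then 0 else 0) i"
    by (rule lincomb_cong) simp
  also have "\<dots> = \<zero>" by (subst lincomb_pad) simp_all
  finally have "a \<odot> w i = lincomb H w ?c (Suc i)"
    using w by (simp add: lincomb_Suc)
  thus ?thesis by (auto simp: lin_span_def)
qed

end

end

lemma total_sequence_iff:
  "total_sequence H w \<longleftrightarrow> (\<forall>n. w n \<in> carrier H) \<and>
     (\<forall>v\<in>carrier H. \<forall>\<epsilon>>0. \<exists>u\<in>lin_span H w. hnorm H (v \<ominus>\<^bsub>H\<^esub> u) < \<epsilon>)"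
proof -
  have "(\<exists>u\<in>lin_span H w. P u) \<longleftrightarrow> (\<exists>n c. P (lincomb H w c n))" for P
    unfolding lin_span_def by auto
  thus ?thesis by (simp add: total_sequence_def lincomb_def)
qed

section \<open>Countable multiples of a Hilbert space\<close>

text \<open>A sequence of vectors is coded as one vector by a pairing function, which keeps the
  \<open>\<ell>\<^sup>2\<close>-sum of copies of a Hilbert space within the type \<open>vec\<close>.\<close>

definition ell2_nth :: "nat \<Rightarrow> vec \<Rightarrow> vec" where
  "ell2_nth n f = (\<lambda>k. f (prod_encode (n, k)))"

definition ell2_pack :: "(nat \<Rightarrow> vec) \<Rightarrow> vec" where
  "ell2_pack g = (\<lambda>i. case prod_decode i of (n, k) \<Rightarrow> g n k)"

lemma ell2_nth_pack [simp]: "ell2_nth n (ell2_pack g) = g n"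
  by (simp add: ell2_nth_def ell2_pack_def)

lemma ell2_pack_nth: "ell2_pack (\<lambda>n. ell2_nth n f) = f"
  by (simp add: ell2_nth_def ell2_pack_def fun_eq_iff split: prod.split)

text \<open>The pairing function is a bijection, so the components determine every coded vector,
  inside the carrier or not. Identities in \<open>ell2\<close> thereby reduce to identities in the
  original space.\<close>

lemma ell2_eqI:
  assumes "\<And>n. ell2_nth n f = ell2_nth n g"
  shows "f = g"
proof -
  have "ell2_pack (\<lambda>n. ell2_nth n f) = ell2_pack (\<lambda>n. ell2_nth n g)"
    by (simp only: assms)
  thus ?thesis by (simp only: ell2_pack_nth)
qed

text \<open>Zero, sum and scalar multiple are formed componentwise without reference to the carrier,
  so their component rules hold unconditionally. The series in \<open>hinner\<close> is guaranteed
  to converge for elements of the carrier.\<close>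

definition ell2 :: "vec hilbert \<Rightarrow> vec hilbert" where
  "ell2 H =
    \<lparr>carrier = {f. (\<forall>n. ell2_nth n f \<in> carrier H) \<and> summable (\<lambda>n. (hnorm H (ell2_nth n f))\<^sup>2)},
     monoid.mult = undefined, one = undefined,
     zero = ell2_pack (\<lambda>_. \<zero>\<^bsub>H\<^esub>),
     add = (\<lambda>f g. ell2_pack (\<lambda>n. ell2_nth n f \<oplus>\<^bsub>H\<^esub> ell2_nth n g)),
     module.smult = (\<lambda>c f. ell2_pack (\<lambda>n. c \<odot>\<^bsub>H\<^esub> ell2_nth n f)),
     hinner = (\<lambda>f g. \<Sum>n. hinner H (ell2_nth n f) (ell2_nth n g))\<rparr>"

lemma ell2_carrier_iff:
  "f \<in> carrier (ell2 H) \<longleftrightarrow>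
     (\<forall>n. ell2_nth n f \<in> carrier H) \<and> summable (\<lambda>n. (hnorm H (ell2_nth n f))\<^sup>2)"
  by (simp add: ell2_def)

lemma ell2_nth_closed [simp]: "f \<in> carrier (ell2 H) \<Longrightarrow> ell2_nth n f \<in> carrier H"
  by (simp add: ell2_carrier_iff)

lemma ell2_nth_ops [simp]:
  "ell2_nth n (\<zero>\<^bsub>ell2 H\<^esub>) = \<zero>\<^bsub>H\<^esub>"
  "ell2_nth n (f \<oplus>\<^bsub>ell2 H\<^esub> g) = ell2_nth n f \<oplus>\<^bsub>H\<^esub> ell2_nth n g"
  "ell2_nth n (c \<odot>\<^bsub>ell2 H\<^esub> f) = c \<odot>\<^bsub>H\<^esub> ell2_nth n f"
  unfolding ell2_def by (simp_all only: ring.simps module.simps ell2_nth_pack)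

lemma hinner_ell2: "hinner (ell2 H) f g = (\<Sum>n. hinner H (ell2_nth n f) (ell2_nth n g))"
  by (simp only: ell2_def hilbert.simps)

locale hilbert_multiple = complex_hilbert_space H for H :: "vec hilbert" (structure)
begin

lemma ell2_zero_closed: "\<zero>\<^bsub>ell2 H\<^esub> \<in> carrier (ell2 H)"
  by (simp add: ell2_carrier_iff hnorm_def)

lemma summable_ell2_add:
  assumes "f \<in> carrier (ell2 H)" "g \<in> carrier (ell2 H)"
  shows "summable (\<lambda>n. (hnorm H (ell2_nth n f \<oplus> ell2_nth n g))\<^sup>2)"
proof (rule summable_comparison_test'[where N = 0])
  show "summable (\<lambda>n. 2 * (hnorm H (ell2_nth n f))\<^sup>2 + 2 * (hnorm H (ell2_nth n g))\<^sup>2)"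
    using assms by (intro summable_add summable_mult) (simp_all add: ell2_carrier_iff)
qed (use assms in \<open>simp add: hnorm_add_sq_le\<close>)

lemma ell2_add_closed:
  "f \<in> carrier (ell2 H) \<Longrightarrow> g \<in> carrier (ell2 H) \<Longrightarrow> f \<oplus>\<^bsub>ell2 H\<^esub> g \<in> carrier (ell2 H)"
  by (subst ell2_carrier_iff) (simp add: summable_ell2_add)

lemma ell2_smult_closed:
  "f \<in> carrier (ell2 H) \<Longrightarrow> c \<odot>\<^bsub>ell2 H\<^esub> f \<in> carrier (ell2 H)"
  by (simp add: ell2_carrier_iff hnorm_smult power_mult_distrib summable_mult)

lemma abelian_group_ell2: "abelian_group (ell2 H)"
proof (rule abelian_groupI)
  fix f assume f: "f \<in> carrier (ell2 H)"
  have "(- 1) \<odot>\<^bsub>ell2 H\<^esub> f \<oplus>\<^bsub>ell2 H\<^esub> f = \<zero>\<^bsub>ell2 H\<^esub>"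
    by (rule ell2_eqI) (use f in \<open>simp add: smult_minus_one l_neg\<close>)
  thus "\<exists>g\<in>carrier (ell2 H). g \<oplus>\<^bsub>ell2 H\<^esub> f = \<zero>\<^bsub>ell2 H\<^esub>"
    using f ell2_smult_closed by blast
qed (rule ell2_zero_closed ell2_add_closed ell2_eqI; simp add: a_ac)+

lemma module_ell2: "Module.module complex_field (ell2 H)"
proof (rule moduleI)
qed (rule cring_complex_field abelian_group_ell2 ell2_smult_closed ell2_eqI;
     simp add: smult_add_left smult_r_distr smult_smult)+

lemma summable_norm_ell2_inner:
  assumes "f \<in> carrier (ell2 H)" "g \<in> carrier (ell2 H)"
  shows "summable (\<lambda>n. cmod (hinner H (ell2_nth n f) (ell2_nth n g)))"
proof (rule summable_comparison_test'[where N = 0])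
  show "summable (\<lambda>n. (hnorm H (ell2_nth n f))\<^sup>2 + (hnorm H (ell2_nth n g))\<^sup>2)"
    using assms by (intro summable_add) (simp_all add: ell2_carrier_iff)
  show "norm (cmod (hinner H (ell2_nth n f) (ell2_nth n g))) \<le>
      (hnorm H (ell2_nth n f))\<^sup>2 + (hnorm H (ell2_nth n g))\<^sup>2" for n
    using cmod_inner_le[OF ell2_nth_closed[OF assms(1)] ell2_nth_closed[OF assms(2)], of n n]
      norm_ge_zero[of "hinner H (ell2_nth n f) (ell2_nth n g)"] unfolding real_norm_def abs_norm_cancel by linarith
qed

lemma summable_ell2_inner:
  "f \<in> carrier (ell2 H) \<Longrightarrow> g \<in> carrier (ell2 H) \<Longrightarrow>
     summable (\<lambda>n. hinner H (ell2_nth n f) (ell2_nth n g))"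
  by (rule summable_norm_cancel) (rule summable_norm_ell2_inner)

lemma hinner_ell2_self:
  assumes "f \<in> carrier (ell2 H)"
  shows "hinner (ell2 H) f f = of_real (\<Sum>n. (hnorm H (ell2_nth n f))\<^sup>2)"
  using assms by (simp add: hinner_ell2 inner_self suminf_of_real ell2_carrier_iff del: of_real_power)

lemma hnorm_ell2_sq:
  assumes "f \<in> carrier (ell2 H)"
  shows "(hnorm (ell2 H) f)\<^sup>2 = (\<Sum>n. (hnorm H (ell2_nth n f))\<^sup>2)"
proof -
  have "0 \<le> (\<Sum>n. (hnorm H (ell2_nth n f))\<^sup>2)"
    using assms by (intro suminf_nonneg) (simp_all add: ell2_carrier_iff)
  thus ?thesis using hinner_ell2_self[OF assms] by (simp add: hnorm_def)
qed

text \<open>Subtraction goes through the additive inverse, which is a definite description over the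
  carrier. Hence the membership assumptions, unlike for the sum; the inverse is identified with the
  multiple by -1.\<close>

lemma ell2_nth_minus [simp]:
  assumes "f \<in> carrier (ell2 H)" "g \<in> carrier (ell2 H)"
  shows "ell2_nth n (f \<ominus>\<^bsub>ell2 H\<^esub> g) = ell2_nth n f \<ominus> ell2_nth n g"
proof -
  interpret E: Module.module complex_field "ell2 H" by (rule module_ell2)
  have "(- 1) \<odot>\<^bsub>ell2 H\<^esub> g \<oplus>\<^bsub>ell2 H\<^esub> g = \<zero>\<^bsub>ell2 H\<^esub>"
    by (rule ell2_eqI) (use assms in \<open>simp add: smult_minus_one l_neg\<close>)
  hence "\<ominus>\<^bsub>ell2 H\<^esub> g = (- 1) \<odot>\<^bsub>ell2 H\<^esub> g"
    using assms ell2_smult_closed E.minus_equality by blast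
  thus ?thesis using assms by (simp add: a_minus_def smult_minus_one)
qed

text \<open>Each component is a Cauchy sequence, because its distances are bounded by those in the
  sum. All estimates on the componentwise limit are made on finite partial sums, where one index may
  tend to infinity term by term, and only afterwards extended to the whole series.\<close>

lemma complete_ell2:
  assumes f: "\<And>n. f n \<in> carrier (ell2 H)"
    and Cauchy: "\<And>\<epsilon>. \<epsilon> > 0 \<Longrightarrow> \<exists>N. \<forall>m\<ge>N. \<forall>n\<ge>N. hnorm (ell2 H) (f m \<ominus>\<^bsub>ell2 H\<^esub> f n) < \<epsilon>"
  shows "\<exists>v\<in>carrier (ell2 H). (\<lambda>n. hnorm (ell2 H) (f n \<ominus>\<^bsub>ell2 H\<^esub> v)) \<longlonglongrightarrow> 0"
proof -
  interpret E: Module.module complex_field "ell2 H" by (rule module_ell2)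
  let ?d = "\<lambda>i j k. (hnorm H (ell2_nth k (f i) \<ominus> ell2_nth k (f j)))\<^sup>2"
  have dE: "f i \<ominus>\<^bsub>ell2 H\<^esub> f j \<in> carrier (ell2 H)" for i j
    using f by simp
  have norm_d: "(hnorm (ell2 H) (f i \<ominus>\<^bsub>ell2 H\<^esub> f j))\<^sup>2 = (\<Sum>k. ?d i j k)" for i j
    using f by (simp add: hnorm_ell2_sq)
  have sum_d: "summable (?d i j)" for i j
    using dE[of i j] f by (simp add: ell2_carrier_iff)
  have hnorm_E_nonneg: "0 \<le> hnorm (ell2 H) u" if "u \<in> carrier (ell2 H)" for u
    using that suminf_nonneg[of "\<lambda>n. (hnorm H (ell2_nth n u))\<^sup>2"]
    by (simp add: hnorm_def hinner_ell2_self ell2_carrier_iff)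
  define D where "D i j = hnorm (ell2 H) (f i \<ominus>\<^bsub>ell2 H\<^esub> f j)" for i j
  have D_nonneg: "0 \<le> D i j" for i j
    unfolding D_def by (rule hnorm_E_nonneg[OF dE])
  have partial: "(\<Sum>k\<in>K. ?d i j k) \<le> (D i j)\<^sup>2" if "finite K" for i j K
    unfolding D_def norm_d by (rule sum_le_suminf[OF sum_d that]) simp
  have D_Cauchy: "\<exists>N. \<forall>i\<ge>N. \<forall>j\<ge>N. D i j < \<epsilon>" if "\<epsilon> > 0" for \<epsilon>
    unfolding D_def by (rule Cauchy[OF that])
  have "\<exists>v\<in>carrier H. (\<lambda>i. hnorm H (ell2_nth k (f i) \<ominus> v)) \<longlonglongrightarrow> 0" for k
  proof (rule complete)
    fix \<epsilon> :: real assume "\<epsilon> > 0"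
    then obtain N where N: "\<forall>i\<ge>N. \<forall>j\<ge>N. D i j < \<epsilon>"
      using D_Cauchy by blast
    have "hnorm H (ell2_nth k (f i) \<ominus> ell2_nth k (f j)) \<le> D i j" for i j
      by (rule power2_le_imp_le) (use partial[of "{k}" i j] D_nonneg in auto)
    thus "\<exists>N. \<forall>i\<ge>N. \<forall>j\<ge>N. hnorm H (ell2_nth k (f i) \<ominus> ell2_nth k (f j)) < \<epsilon>"
      using N by (meson le_less_trans)
  qed (use f in simp)
  then obtain v where v: "\<And>k. v k \<in> carrier H"
    and lim: "\<And>k. (\<lambda>i. hnorm H (ell2_nth k (f i) \<ominus> v k)) \<longlonglongrightarrow> 0"
    by metis
  let ?e = "\<lambda>i k. (hnorm H (ell2_nth k (f i) \<ominus> v k))\<^sup>2"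
  \<comment> \<open>Go from \<open>f i\<close> to the limit through \<open>f j\<close> and let
    \<open>j\<close> tend to infinity; the factor 2 comes from the squared triangle
    inequality.\<close>
  have bound: "(\<Sum>k<K. ?e i k) \<le> 2 * \<epsilon>\<^sup>2"
    if N: "\<forall>i\<ge>N. \<forall>j\<ge>N. D i j < \<epsilon>" and i: "i \<ge> N"
    for N \<epsilon> i K
  proof -
    have "(\<lambda>j. 2 * \<epsilon>\<^sup>2 + 2 * (\<Sum>k<K. ?e j k)) \<longlonglongrightarrow> 2 * \<epsilon>\<^sup>2 + 2 * (\<Sum>k<K. 0\<^sup>2)"
      by (intro tendsto_intros lim)
    moreover have "(\<Sum>k<K. ?e i k) \<le> 2 * \<epsilon>\<^sup>2 + 2 * (\<Sum>k<K. ?e j k)" if "j \<ge> N" for j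
    proof -
      have "(\<Sum>k<K. ?e i k) \<le> (\<Sum>k<K. 2 * ?d i j k + 2 * ?e j k)"
        using f v by (intro sum_mono hnorm_dist_sq_le) simp_all
      also have "\<dots> = 2 * (\<Sum>k<K. ?d i j k) + 2 * (\<Sum>k<K. ?e j k)"
        by (simp add: sum.distrib sum_distrib_left)
      also have "(\<Sum>k<K. ?d i j k) \<le> \<epsilon>\<^sup>2"
        using order_trans[OF partial[of "{..<K}" i j] power_mono[of "D i j" \<epsilon> 2]]
          D_nonneg[of i j] N i that by (simp add: less_imp_le)
      finally show ?thesis by simp
    qed
    ultimately have "(\<Sum>k<K. ?e i k) \<le> 2 * \<epsilon>\<^sup>2 + 2 * (\<Sum>k<K. 0\<^sup>2)"
      by (intro LIMSEQ_le_const) auto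
    thus ?thesis by simp
  qed
  \<comment> \<open>One index with finite distance to the limit suffices to put the limit in the
    carrier: \<open>v\<close> is compared with \<open>f N1\<close>, and the bound 1 is
    arbitrary.\<close>
  obtain N1 where N1: "\<forall>i\<ge>N1. \<forall>j\<ge>N1. D i j < 1"
    using D_Cauchy[OF zero_less_one] by blast
  have vE: "ell2_pack v \<in> carrier (ell2 H)"
  proof -
    have "summable (?e N1)"
      by (rule bounded_imp_summable[where B = "2 * 1\<^sup>2"])
        (use bound[OF N1 order_refl, of "Suc _"] in \<open>simp_all only: lessThan_Suc_atMost zero_le_power2\<close>)
    hence major: "summable (\<lambda>k. 2 * (hnorm H (ell2_nth k (f N1)))\<^sup>2 + 2 * ?e N1 k)"
      using f[of N1] by (intro summable_add summable_mult) (simp_all add: ell2_carrier_iff)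
    have "(hnorm H (v k))\<^sup>2 \<le> 2 * (hnorm H (ell2_nth k (f N1)))\<^sup>2 + 2 * ?e N1 k" for k
      using hnorm_dist_sq_le[of \<zero> "ell2_nth k (f N1)" "v k"] v[of k] f[of N1]
        hnorm_minus_sq[of \<zero> "v k"] hnorm_minus_sq[of \<zero> "ell2_nth k (f N1)"] by simp
    hence "summable (\<lambda>k. (hnorm H (v k))\<^sup>2)"
      by (intro summable_comparison_test_ev[OF _ major]) simp
    thus ?thesis using v by (simp add: ell2_carrier_iff)
  qed
  have "(\<lambda>i. hnorm (ell2 H) (f i \<ominus>\<^bsub>ell2 H\<^esub> ell2_pack v)) \<longlonglongrightarrow> 0"
  proof (rule LIMSEQ_I)
    fix r :: real assume r: "r > 0"
    \<comment> \<open>With \<open>r / 2\<close> the factor 2 in \<open>bound\<close> leaves half of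
      the square of \<open>r\<close>, hence a strict inequality.\<close>
    then obtain N where N: "\<forall>i\<ge>N. \<forall>j\<ge>N. D i j < r / 2"
      using D_Cauchy[of "r / 2"] by auto
    have "norm (hnorm (ell2 H) (f i \<ominus>\<^bsub>ell2 H\<^esub> ell2_pack v) - 0) < r" if i: "i \<ge> N" for i
    proof -
      have iv: "f i \<ominus>\<^bsub>ell2 H\<^esub> ell2_pack v \<in> carrier (ell2 H)" using f vE by simp
      have "(hnorm (ell2 H) (f i \<ominus>\<^bsub>ell2 H\<^esub> ell2_pack v))\<^sup>2 = (\<Sum>k. ?e i k)"
        using f vE iv by (simp add: hnorm_ell2_sq)
      also have "\<dots> \<le> 2 * (r / 2)\<^sup>2"
        using bound[OF N i] iv f vE by (intro suminf_le_const) (simp_all add: ell2_carrier_iff)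
      also have "\<dots> < r\<^sup>2" using r by (simp add: power2_eq_square field_simps)
      finally show ?thesis using r hnorm_E_nonneg[OF iv] by (simp add: power2_less_imp_less)
    qed
    thus "\<exists>N. \<forall>i\<ge>N. norm (hnorm (ell2 H) (f i \<ominus>\<^bsub>ell2 H\<^esub> ell2_pack v) - 0) < r" by blast
  qed
  thus ?thesis using vE by blast
qed

lemma complex_hilbert_space_ell2: "complex_hilbert_space (ell2 H)"
proof (intro complex_hilbert_space.intro complex_hilbert_space_axioms.intro module_ell2 complete_ell2)
  fix u v w assume "u \<in> carrier (ell2 H)" "v \<in> carrier (ell2 H)" "w \<in> carrier (ell2 H)"
  thus "hinner (ell2 H) (u \<oplus>\<^bsub>ell2 H\<^esub> v) w = hinner (ell2 H) u w + hinner (ell2 H) v w"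
    by (simp add: hinner_ell2 inner_add suminf_add summable_ell2_inner)
next
  fix v w c assume "v \<in> carrier (ell2 H)" "w \<in> carrier (ell2 H)"
  thus "hinner (ell2 H) (c \<odot>\<^bsub>ell2 H\<^esub> v) w = c * hinner (ell2 H) v w"
    by (simp add: hinner_ell2 inner_smult suminf_mult summable_ell2_inner)
next
  fix v w assume vw: "v \<in> carrier (ell2 H)" "w \<in> carrier (ell2 H)"
  have "(\<lambda>n. cnj (hinner H (ell2_nth n v) (ell2_nth n w))) sums cnj (hinner (ell2 H) v w)"
    unfolding hinner_ell2 sums_cnj by (rule summable_sums[OF summable_ell2_inner[OF vw]])
  also have "(\<lambda>n. cnj (hinner H (ell2_nth n v) (ell2_nth n w))) =
      (\<lambda>n. hinner H (ell2_nth n w) (ell2_nth n v))"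
    by (intro ext inner_cnj[symmetric] ell2_nth_closed vw)
  finally show "hinner (ell2 H) w v = cnj (hinner (ell2 H) v w)"
    unfolding hinner_ell2[of H w v] by (rule sums_unique[symmetric])
next
  fix v assume v: "v \<in> carrier (ell2 H)"
  show "0 \<le> Re (hinner (ell2 H) v v)"
    using v suminf_nonneg[of "\<lambda>n. (hnorm H (ell2_nth n v))\<^sup>2"]
    by (simp add: hinner_ell2_self ell2_carrier_iff)
  assume "hinner (ell2 H) v v = 0"
  hence "(\<Sum>n. (hnorm H (ell2_nth n v))\<^sup>2) = 0"
    using v by (simp only: hinner_ell2_self of_real_eq_0_iff)
  hence "(hnorm H (ell2_nth n v))\<^sup>2 = 0" for n
    using v by (subst (asm) suminf_eq_zero_iff) (auto simp: ell2_carrier_iff)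
  hence "ell2_nth n v = \<zero>" for n
    using v by simp
  thus "v = \<zero>\<^bsub>ell2 H\<^esub>"
    by (rule_tac ell2_eqI) simp
qed auto

end

definition ell2_single :: "vec hilbert \<Rightarrow> nat \<Rightarrow> vec \<Rightarrow> vec" where
  "ell2_single H n v = ell2_pack (\<lambda>m. if m = n then v else \<zero>\<^bsub>H\<^esub>)"

text \<open>Here the pairing function enumerates a doubly indexed family (the copy, the vector
  placed in it); this is separate from its use in coding a sequence of vectors as one
  vector.\<close>

definition ell2_fund :: "vec hilbert \<Rightarrow> (nat \<Rightarrow> vec) \<Rightarrow> nat \<Rightarrow> vec" where
  "ell2_fund H w i = (case prod_decode i of (n, k) \<Rightarrow> ell2_single H n (w k))"

context hilbert_multiple
begin

lemma ell2_single_closed: "v \<in> carrier H \<Longrightarrow> ell2_single H n v \<in> carrier (ell2 H)"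
  by (auto simp: ell2_carrier_iff ell2_single_def split: if_splits intro!: summable_finite[of "{n}"])

lemma hinner_ell2_single:
  assumes "f \<in> carrier (ell2 H)" "v \<in> carrier H"
  shows "hinner (ell2 H) f (ell2_single H n v) = hinner H (ell2_nth n f) v"
proof -
  have "hinner (ell2 H) f (ell2_single H n v) =
      (\<Sum>m\<in>{n}. hinner H (ell2_nth m f) (ell2_nth m (ell2_single H n v)))"
    unfolding hinner_ell2 using assms by (intro suminf_finite) (simp_all add: ell2_single_def)
  thus ?thesis by (simp add: ell2_single_def)
qed

text \<open>Cut \<open>f\<close> off after finitely many components and approximate each remaining
  one in the span of \<open>w\<close>. The squared error splits into the tail of \<open>f\<close>
  and the finitely many approximation errors, each contributing at most half of the square of
  \<epsilon>.\<close>

lemma total_sequence_ell2: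
  assumes "total_sequence H w"
  shows "total_sequence (ell2 H) (ell2_fund H w)"
proof -
  interpret E: complex_hilbert_space "ell2 H" by (rule complex_hilbert_space_ell2)
  let ?W = "ell2_fund H w"
  have w: "\<And>k. w k \<in> carrier H" and dense: "\<And>v \<epsilon>. v \<in> carrier H \<Longrightarrow> \<epsilon> > 0 \<Longrightarrow>
      \<exists>u\<in>lin_span H w. hnorm H (v \<ominus> u) < \<epsilon>"
    using assms by (auto simp: total_sequence_iff)
  have W: "ell2_fund H w i \<in> carrier (ell2 H)" for i
    using w by (auto simp: ell2_fund_def ell2_single_closed split: prod.split)
  have single: "ell2_single H n v \<in> lin_span (ell2 H) ?W" if v: "v \<in> lin_span H w" for n v
  proof -
    have "ell2_single H n (lincomb H w c m) \<in> lin_span (ell2 H) ?W" for c m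
    proof (induction m)
      case 0
      have "ell2_single H n \<zero> = \<zero>\<^bsub>ell2 H\<^esub>"
        by (rule ell2_eqI) (simp add: ell2_single_def)
      thus ?case using w E.lin_span_zero[of ?W, OF W] by (simp add: lincomb_0)
    next
      case (Suc m)
      have "ell2_single H n (lincomb H w c (Suc m)) =
          c m \<odot>\<^bsub>ell2 H\<^esub> ?W (prod_encode (n, m)) \<oplus>\<^bsub>ell2 H\<^esub> ell2_single H n (lincomb H w c m)"
        by (rule ell2_eqI) (simp add: ell2_single_def ell2_fund_def lincomb_Suc[of w, OF w])
      thus ?case using E.lin_span_add[of ?W, OF W E.lin_span_smult[of ?W, OF W] Suc] by simp
    qed
    thus ?thesis using v by (auto simp: lin_span_def)
  qed
  have pack: "ell2_pack (\<lambda>n. if n < M then u n else \<zero>) \<in> lin_span (ell2 H) ?W"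
    if u: "\<And>n. u n \<in> lin_span H w" for u M
  proof (induction M)
    case 0
    have "ell2_pack (\<lambda>n. \<zero>) = \<zero>\<^bsub>ell2 H\<^esub>"
      by (rule ell2_eqI) simp
    thus ?case using E.lin_span_zero[of ?W, OF W] by simp
  next
    case (Suc M)
    have uc: "u n \<in> carrier H" for n using u lin_span_closed[of w, OF w] by blast
    have "ell2_pack (\<lambda>n. if n < Suc M then u n else \<zero>) =
        ell2_single H M (u M) \<oplus>\<^bsub>ell2 H\<^esub> ell2_pack (\<lambda>n. if n < M then u n else \<zero>)"
      by (rule ell2_eqI) (use uc in \<open>auto simp: ell2_single_def less_Suc_eq\<close>)
    thus ?case using E.lin_span_add[of ?W, OF W single[OF u] Suc] by simp
  qed
  have "\<exists>g\<in>lin_span (ell2 H) ?W. hnorm (ell2 H) (f \<ominus>\<^bsub>ell2 H\<^esub> g) < \<epsilon>"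
    if f: "f \<in> carrier (ell2 H)" and \<epsilon>: "\<epsilon> > 0" for f and \<epsilon> :: real
  proof -
    let ?a = "\<lambda>n. (hnorm H (ell2_nth n f))\<^sup>2"
    have sum_a: "summable ?a" using f by (simp add: ell2_carrier_iff)
    obtain M where M: "norm (\<Sum>n. ?a (n + M)) < \<epsilon>\<^sup>2 / 2"
      using suminf_exist_split[OF _ sum_a, of "\<epsilon>\<^sup>2 / 2"] \<epsilon> by (metis half_gt_zero order_refl zero_less_power)
    \<comment> \<open>A bound for the squared error in each of the \<open>M\<close> components kept;
      their sum is then at most half of the square of \<epsilon>. \<open>Suc M\<close> keeps the
      quotient positive when \<open>M\<close> is 0.\<close>
    define \<delta> where "\<delta> = \<epsilon>\<^sup>2 / (2 * real (Suc M))"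
    have \<delta>: "\<delta> > 0" using \<epsilon> by (simp add: \<delta>_def)
    have "\<exists>u\<in>lin_span H w. hnorm H (ell2_nth n f \<ominus> u) < sqrt \<delta>" for n
      using dense[of "ell2_nth n f" "sqrt \<delta>"] f \<delta> by simp
    then obtain u where u: "\<And>n. u n \<in> lin_span H w"
      and u_close: "\<And>n. hnorm H (ell2_nth n f \<ominus> u n) < sqrt \<delta>" by metis
    have uc: "u n \<in> carrier H" for n using u lin_span_closed[of w, OF w] by blast
    define g where "g = ell2_pack (\<lambda>n. if n < M then u n else \<zero>)"
    have g: "g \<in> lin_span (ell2 H) ?W" unfolding g_def by (rule pack[OF u])
    hence gc: "g \<in> carrier (ell2 H)" using E.lin_span_closed[of ?W, OF W] by blast
    let ?d = "\<lambda>n. (hnorm H (ell2_nth n (f \<ominus>\<^bsub>ell2 H\<^esub> g)))\<^sup>2"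
    have fg: "f \<ominus>\<^bsub>ell2 H\<^esub> g \<in> carrier (ell2 H)" using f gc by simp
    have d_init: "?d n \<le> \<delta>" if "n < M" for n
    proof -
      have "?d n = (hnorm H (ell2_nth n f \<ominus> u n))\<^sup>2"
        using that f gc by (simp add: g_def)
      also have "\<dots> \<le> (sqrt \<delta>)\<^sup>2"
        by (rule power_mono) (use u_close[of n] f uc in \<open>auto simp: less_imp_le complex_hilbert_space_axioms\<close>)
      finally show ?thesis using \<delta> by simp
    qed
    have d_tail: "?d (n + M) = ?a (n + M)" for n
      using f gc hnorm_minus_sq[of "ell2_nth (n + M) f" \<zero>] by (simp add: g_def)
    have "(hnorm (ell2 H) (f \<ominus>\<^bsub>ell2 H\<^esub> g))\<^sup>2 = (\<Sum>n. ?d (n + M)) + (\<Sum>n<M. ?d n)"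
      using fg by (subst hnorm_ell2_sq[OF fg], subst suminf_split_initial_segment[where k = M])
        (simp_all add: ell2_carrier_iff)
    also have "\<dots> < \<epsilon>\<^sup>2 / 2 + (\<Sum>n<M. \<delta>)"
      using M d_init unfolding d_tail by (intro add_less_le_mono sum_mono) auto
    also have "\<dots> \<le> \<epsilon>\<^sup>2"
      by (simp add: \<delta>_def field_simps)
    finally show ?thesis
      using g \<epsilon> by (meson less_imp_le power_less_imp_less_base)
  qed
  thus ?thesis using W by (auto simp: total_sequence_iff)
qed

end

section \<open>Borel sections\<close>

lemma countable_dense_sequence:
  fixes D :: "'a::metric_space set"
  assumes "\<And>X. open X \<Longrightarrow> X \<noteq> {} \<Longrightarrow> \<exists>d\<in>D. d \<in> X"
  shows "\<exists>s. (\<forall>k. s k \<in> D) \<and> s \<longlonglongrightarrow> z"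
proof -
  have "\<exists>d\<in>D. dist d z < 1 / real (Suc k)" for k
    using assms[of "ball z (1 / real (Suc k))"] by (auto simp: dist_commute)
  then obtain s where s: "\<And>k. s k \<in> D" "\<And>k. dist (s k) z < 1 / real (Suc k)" by metis
  have "s \<longlonglongrightarrow> z"
    by (rule metric_tendsto_imp_tendsto[OF LIMSEQ_inverse_real_of_nat])
       (use s(2) in \<open>auto intro!: always_eventually less_imp_le simp: inverse_eq_divide\<close>)
  thus ?thesis using s(1) by blast
qed

text \<open>The subtracted term involves only the inner products of \<open>v\<close> with the
  \<open>w i\<close> and the Gram matrix of \<open>w\<close>. For a bundle these are Borel functions
  of the base point, and the term is continuous in the coefficients.\<close>

lemma (in complex_hilbert_space) hnorm_minus_lincomb_sq:
  assumes w: "\<And>i. w i \<in> carrier H" and v: "v \<in> carrier H"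
  shows "(hnorm H (v \<ominus> lincomb H w c n))\<^sup>2 = (hnorm H v)\<^sup>2 -
    (2 * Re (\<Sum>i<n. cnj (c i) * hinner H v (w i))
      - Re (\<Sum>i<n. c i * (\<Sum>j<n. cnj (c j) * hinner H (w i) (w j))))"
proof -
  have right: "hinner H u (lincomb H w c n) = (\<Sum>i<n. cnj (c i) * hinner H u (w i))"
    if "u \<in> carrier H" for u
    using inner_cnj[of "lincomb H w c n" u] inner_cnj[of "w _" u] that w
    by (simp add: lincomb_closed inner_lincomb)
  have "hinner H (lincomb H w c n) (lincomb H w c n) =
      (\<Sum>i<n. c i * hinner H (w i) (lincomb H w c n))"
    using w by (intro inner_lincomb lincomb_closed)
  also have "\<dots> = (\<Sum>i<n. c i * (\<Sum>j<n. cnj (c j) * hinner H (w i) (w j)))"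
    by (simp only: right[OF w])
  finally have "(hnorm H (lincomb H w c n))\<^sup>2 =
      Re (\<Sum>i<n. c i * (\<Sum>j<n. cnj (c j) * hinner H (w i) (w j)))"
    using w by (simp only: hnorm_sq lincomb_closed)
  moreover have "hinner H v (lincomb H w c n) = (\<Sum>i<n. cnj (c i) * hinner H v (w i))"
    using v by (rule right)
  ultimately show ?thesis
    using hnorm_minus_sq[OF v lincomb_closed[of w, OF w], of c n] by simp
qed

text \<open>The squared norm of \<open>\<xi>\<close> is the supremum of \<open>\<parallel>\<xi>\<parallel>\<^sup>2 - \<parallel>\<xi> - w\<parallel>\<^sup>2\<close> over a countable set of
  combinations \<open>w\<close> of the fundamental sections, and this difference is Borel.\<close>

lemma borel_measurable_hnorm:
  assumes "hilbert_bundle X \<H>" "\<xi> \<in> borel_sections X \<H>"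
  shows "(\<lambda>x. hnorm (fibre \<H> x) (\<xi> x)) \<in> borel_measurable X"
proof -
  obtain D :: "complex set" where D: "countable D"
    and D_dense: "\<And>X. open X \<Longrightarrow> X \<noteq> {} \<Longrightarrow> \<exists>d\<in>D. d \<in> X"
    using countable_dense_exists[where 'a = complex] by auto
  define g where "g n c x = 2 * Re (\<Sum>i<n. cnj (c i) * hinner (fibre \<H> x) (\<xi> x) (fund \<H> i x))
      - Re (\<Sum>i<n. c i * (\<Sum>j<n. cnj (c j) * hinner (fibre \<H> x) (fund \<H> i x) (fund \<H> j x)))"
    for n :: nat and c :: "nat \<Rightarrow> complex" and x
  have [measurable]: "(\<lambda>x. hinner (fibre \<H> x) (\<xi> x) (fund \<H> i x)) \<in> borel_measurable X"
    "(\<lambda>x. hinner (fibre \<H> x) (fund \<H> i x) (fund \<H> j x)) \<in> borel_measurable X" for i j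
    using assms by (auto simp: hilbert_bundle_def borel_sections_def)
  have g_meas [measurable]: "g n c \<in> borel_measurable X" for n c
    unfolding g_def by measurable
  let ?N = "\<lambda>x. Re (hinner (fibre \<H> x) (\<xi> x) (\<xi> x))"
  \<comment> \<open>Coefficients are recorded as finite lists over \<open>D\<close> because these
    form a countable set, which infinite sequences over \<open>D\<close> need not do.\<close>
  have key: "a < ?N x \<longleftrightarrow> (\<exists>qs\<in>lists D. a < g (length qs) (\<lambda>i. qs ! i) x)"
    if x: "x \<in> space X" for a x
  proof -
    interpret complex_hilbert_space "fibre \<H> x"
      using assms x by (auto simp: hilbert_bundle_def)
    let ?H = "fibre \<H> x" and ?w = "\<lambda>i. fund \<H> i x"
    have w: "\<And>i. ?w i \<in> carrier ?H" and \<xi>: "\<xi> x \<in> carrier ?H"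
      and dense: "\<And>v \<epsilon>. v \<in> carrier ?H \<Longrightarrow> \<epsilon> > 0 \<Longrightarrow> \<exists>u\<in>lin_span ?H ?w. hnorm ?H (v \<ominus>\<^bsub>?H\<^esub> u) < \<epsilon>"
      using assms x by (auto simp: hilbert_bundle_def borel_sections_def total_sequence_iff)
    have g: "(hnorm ?H (\<xi> x \<ominus>\<^bsub>?H\<^esub> lincomb ?H ?w c n))\<^sup>2 = ?N x - g n c x" for n c
      using hnorm_minus_lincomb_sq[where c = c and n = n, OF w \<xi>] \<xi> by (simp add: g_def hnorm_sq)
    show ?thesis
    proof
      assume a: "a < ?N x"
      then obtain u where u: "u \<in> lin_span ?H ?w" "hnorm ?H (\<xi> x \<ominus>\<^bsub>?H\<^esub> u) < sqrt (?N x - a)"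
        using dense[OF \<xi>, of "sqrt (?N x - a)"] by auto
      then obtain c n where cn: "u = lincomb ?H ?w c n" by (auto simp: lin_span_def)
      have uc: "u \<in> carrier ?H" using w by (simp add: cn lincomb_closed)
      have "(hnorm ?H (\<xi> x \<ominus>\<^bsub>?H\<^esub> u))\<^sup>2 < (sqrt (?N x - a))\<^sup>2"
        by (rule power_strict_mono) (use u uc \<xi> in \<open>auto simp: complex_hilbert_space_axioms\<close>)
      hence "a < g n c x" using a by (simp add: cn g)
      \<comment> \<open>The strict inequality survives a small change of the coefficients, so these
        can be moved into \<open>D\<close>.\<close>
      moreover have "\<forall>i. \<exists>s. (\<forall>k. s k \<in> D) \<and> s \<longlonglongrightarrow> c i"
        using countable_dense_sequence[OF D_dense] by blast
      then obtain s where sD: "\<And>i k. s i k \<in> D" and s: "\<And>i. s i \<longlonglongrightarrow> c i" by metis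
      have "(\<lambda>k. g n (\<lambda>i. s i k) x) \<longlonglongrightarrow> g n c x"
        unfolding g_def by (intro tendsto_intros s)
      ultimately have "\<forall>\<^sub>F k in sequentially. a < g n (\<lambda>i. s i k) x"
        by (simp add: order_tendstoD(1))
      then obtain k where k: "a < g n (\<lambda>i. s i k) x"
        by (auto simp: eventually_sequentially)
      let ?qs = "map (\<lambda>i. s i k) [0..<n]"
      have "g (length ?qs) (\<lambda>i. ?qs ! i) x = g n (\<lambda>i. s i k) x"
        by (simp add: g_def)
      thus "\<exists>qs\<in>lists D. a < g (length qs) (\<lambda>i. qs ! i) x"
        using k sD by (intro bexI[of _ ?qs]) auto
    next
      assume "\<exists>qs\<in>lists D. a < g (length qs) (\<lambda>i. qs ! i) x"
      then obtain n c where "a < g n c x" by blast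
      also have "\<dots> \<le> ?N x" using g[of c n] zero_le_power2[of "hnorm ?H (\<xi> x \<ominus>\<^bsub>?H\<^esub> lincomb ?H ?w c n)"] by linarith
      finally show "a < ?N x" .
    qed
  qed
  have "?N \<in> borel_measurable X"
  proof (subst borel_measurable_iff_greater, intro allI)
    fix a
    have "{x \<in> space X. a < ?N x} = (\<Union>qs\<in>lists D. {x \<in> space X. a < g (length qs) (\<lambda>i. qs ! i) x})"
      using key by auto
    also have "\<dots> \<in> sets X"
      using D by (intro sets.countable_UN'' countable_lists) measurable
    finally show "{x \<in> space X. a < ?N x} \<in> sets X" .
  qed
  thus ?thesis unfolding hnorm_def by measurable
qed

section \<open>Measured groupoids\<close>

lemma equivalent_measures_AE:
  assumes "equivalent_measures \<mu> \<nu>"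
  shows "(AE x in \<mu>. P x) \<longleftrightarrow> (AE x in \<nu>. P x)"
  using assms absolutely_continuous_AE[of \<mu> \<nu> P] absolutely_continuous_AE[of \<nu> \<mu> P]
  by (auto simp: equivalent_measures_def)

lemma class_of_measure_AE:
  "\<nu> \<in> class_of_measure \<mu> \<Longrightarrow> (AE x in \<nu>. P x) \<longleftrightarrow> (AE x in \<mu>. P x)"
  by (auto simp: class_of_measure_def equivalent_measures_AE)

lemma class_of_measure_sets: "\<nu> \<in> class_of_measure \<mu> \<Longrightarrow> sets \<nu> = sets \<mu>"
  by (simp add: class_of_measure_def equivalent_measures_def)

lemma measure_class_AE:
  assumes "measure_class M C" "\<nu> \<in> C"
  shows "AE_class C P \<longleftrightarrow> (AE x in \<nu>. P x)"
proof -
  obtain \<mu> where C: "C = class_of_measure \<mu>"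
    using assms by (auto simp: measure_class_def)
  show ?thesis
    using assms(2) class_of_measure_AE[of _ \<mu> P] unfolding AE_class_def C by metis
qed

lemma measure_class_sets: "measure_class M C \<Longrightarrow> \<nu> \<in> C \<Longrightarrow> sets \<nu> = sets M"
  using class_of_measure_sets by (auto simp: measure_class_def)

text \<open>Metrizable spaces are T1, so points are closed. This makes the fibres of the range map
  measurable, on which left translation is defined.\<close>

lemma standard_borel_singleton:
  assumes "standard_borel M" "x \<in> space M"
  shows "{x} \<in> sets M"
proof -
  obtain T where T: "completely_metrizable_space T" "topspace T = space M"
    "sets M = sigma_sets (topspace T) {U. openin T U}"
    using assms(1) by (auto simp: standard_borel_def)
  have "t1_space T"
    using T(1) completely_metrizable_imp_metrizable_space metrizable_imp_Hausdorff_space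
      Hausdorff_imp_t1_space by blast
  hence "closedin T {x}"
    using assms(2) T(2) by (simp add: t1_space_closedin_singleton)
  hence "topspace T - {x} \<in> sigma_sets (topspace T) {U. openin T U}"
    by (intro sigma_sets.Basic) (simp add: openin_diff)
  hence "topspace T - (topspace T - {x}) \<in> sigma_sets (topspace T) {U. openin T U}"
    by (rule sigma_sets.Compl)
  thus ?thesis using assms(2) T by (simp add: Diff_Diff_Int Int_absorb1)
qed

text \<open>The properties met below need not define measurable sets, while a conull set of units
  must be Borel; it is therefore shrunk to the complement of a measurable null set.\<close>

lemma AE_obtain_measurable_subset:
  assumes "AE x in M. P x"
  obtains V where "V \<in> sets M" "AE x in M. x \<in> V" "\<And>x. x \<in> V \<Longrightarrow> P x"
proof -
  obtain N where N: "{x \<in> space M. \<not> P x} \<subseteq> N" "emeasure M N = 0" "N \<in> sets M"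
    using assms by (rule AE_E)
  have "AE x in M. x \<in> space M - N"
    using N by (intro AE_I'[of N]) auto
  thus ?thesis using that[of "space M - N"] N by auto
qed

context groupoid
begin

lemma space_unit_space: "space (unit_space G) = rng G ` space (arrows G)"
  using rng_closed by (auto simp: unit_space_def space_restrict_space)

lemma rng_in_unit_space [simp]: "\<gamma> \<in> space (arrows G) \<Longrightarrow> rng G \<gamma> \<in> space (unit_space G)"
  by (simp add: space_unit_space)

lemma src_in_unit_space [simp]: "\<gamma> \<in> space (arrows G) \<Longrightarrow> src G \<gamma> \<in> space (unit_space G)"
  using rng_src[of \<gamma>] src_closed[of \<gamma>] rng_in_unit_space[of "src G \<gamma>"] by simp

end

context borel_groupoid
begin

lemma rng_measurable_unit [measurable]: "rng G \<in> arrows G \<rightarrow>\<^sub>M unit_space G"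
  unfolding unit_space_def by (intro measurable_restrict_space2 rng_measurable) auto

lemma src_measurable_unit [measurable]: "src G \<in> arrows G \<rightarrow>\<^sub>M unit_space G"
  unfolding unit_space_def
  by (intro measurable_restrict_space2 src_measurable) (simp add: flip: space_unit_space)

lemma fibre_in_sets:
  assumes "x \<in> space (arrows G)"
  shows "{\<eta> \<in> space (arrows G). rng G \<eta> = x} \<in> sets (arrows G)"
proof -
  have "{\<eta> \<in> space (arrows G). rng G \<eta> = x} = rng G -` {x} \<inter> space (arrows G)" by auto
  thus ?thesis
    using standard_borel_singleton[OF standard assms] rng_measurable by (simp add: measurable_sets)
qed

lemma left_mult_measurable:
  assumes "\<gamma> \<in> space (arrows G)"
  shows "(\<lambda>\<eta>. \<gamma> \<cdot> \<eta>) \<in> restrict_space (arrows G) {\<eta> \<in> space (arrows G). rng G \<eta> = src G \<gamma>} \<rightarrow>\<^sub>M arrows G"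
proof -
  have "(\<lambda>\<eta>. (\<gamma>, \<eta>)) \<in> restrict_space (arrows G) {\<eta> \<in> space (arrows G). rng G \<eta> = src G \<gamma>} \<rightarrow>\<^sub>M
      restrict_space (arrows G \<Otimes>\<^sub>M arrows G) {(\<gamma>, \<eta>). src G \<gamma> = rng G \<eta>}"
    using assms by (intro measurable_restrict_space3) auto
  from measurable_comp[OF this mult_measurable] show ?thesis by (simp add: comp_def)
qed

end

text \<open>All members of a measure class have the same null sets, so statements about
  \<open>C\<close> and \<open>unit_class G C\<close> are tested on one representative \<nu>. In the
  main proof it is the measure with the quasi-invariant disintegration.\<close>

locale measured_groupoid_with_prob = borel_groupoid +
  fixes C :: "'a measure set" and \<nu> :: "'a measure"
  assumes measure_class: "measure_class (arrows G) C"
    and symmetric: "symmetric_class G C"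
    and \<nu>_in: "\<nu> \<in> C" and \<nu>_prob: "prob_space \<nu>"
begin

abbreviation "r\<nu> \<equiv> distr \<nu> (unit_space G) (rng G)"

lemma sets_\<nu> [simp]: "sets \<nu> = sets (arrows G)"
  using measure_class_sets[OF measure_class \<nu>_in] .

lemma space_\<nu> [simp]: "space \<nu> = space (arrows G)"
  using sets_\<nu> by (rule sets_eq_imp_space_eq)

lemma rng_measurable_\<nu> [measurable]: "rng G \<in> \<nu> \<rightarrow>\<^sub>M unit_space G"
  using rng_measurable_unit by (simp cong: measurable_cong_sets)

lemma AE_C_iff: "AE_class C P \<longleftrightarrow> (AE \<gamma> in \<nu>. P \<gamma>)"
  by (rule measure_class_AE[OF measure_class \<nu>_in])

lemma AE_unit_class_iff: "AE_class (unit_class G C) P \<longleftrightarrow> (AE x in r\<nu>. P x)"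
proof
  assume *: "AE_class (unit_class G C) P"
  interpret \<nu>: prob_space \<nu> by (rule \<nu>_prob)
  interpret r\<nu>: prob_space r\<nu> by (rule \<nu>.prob_space_distr) measurable
  have "r\<nu> \<in> unit_class G C"
    using \<nu>_in \<nu>_prob r\<nu>.sigma_finite_measure_axioms
    by (auto simp: unit_class_def class_of_measure_def equivalent_measures_def absolutely_continuous_def)
  thus "AE x in r\<nu>. P x" using * by (auto simp: AE_class_def)
next
  assume *: "AE x in r\<nu>. P x"
  \<comment> \<open>Transferring the property to the image of another measure needs a measurable
    set, which \<open>P\<close> need not provide.\<close>
  then obtain V where V: "V \<in> sets r\<nu>" "AE x in r\<nu>. x \<in> V" "\<And>x. x \<in> V \<Longrightarrow> P x"
    by (rule AE_obtain_measurable_subset) blast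
  have [measurable]: "V \<in> sets (unit_space G)" using V(1) by simp
  have "AE x in \<mu>. P x" if \<mu>: "\<mu> \<in> unit_class G C" for \<mu>
  proof -
    obtain \<nu>' where \<nu>': "\<nu>' \<in> C" "\<mu> \<in> class_of_measure (distr \<nu>' (unit_space G) (rng G))"
      using \<mu> by (auto simp: unit_class_def)
    have [measurable]: "rng G \<in> \<nu>' \<rightarrow>\<^sub>M unit_space G"
      using rng_measurable_unit measure_class_sets[OF measure_class \<nu>'(1)]
      by (simp cong: measurable_cong_sets)
    have "AE \<gamma> in \<nu>. rng G \<gamma> \<in> V"
      using AE_distrD[OF rng_measurable_\<nu> V(2)] .
    hence "AE \<gamma> in \<nu>'. rng G \<gamma> \<in> V"
      using measure_class_AE[OF measure_class] \<nu>_in \<nu>'(1) by metis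
    hence "AE x in distr \<nu>' (unit_space G) (rng G). x \<in> V"
      by (subst AE_distr_iff) auto
    hence "AE x in \<mu>. x \<in> V"
      by (simp add: class_of_measure_AE[OF \<nu>'(2)])
    thus ?thesis by (rule eventually_mono) (rule V(3))
  qed
  thus "AE_class (unit_class G C) P" by (simp add: AE_class_def)
qed

lemma conull_borel_iff: "conull_borel G C U \<longleftrightarrow> U \<in> sets (unit_space G) \<and> (AE x in r\<nu>. x \<in> U)"
  by (simp add: conull_borel_def AE_unit_class_iff)

lemma AE_rng:
  assumes "AE x in r\<nu>. P x"
  shows "AE \<gamma> in \<nu>. P (rng G \<gamma>)"
  by (rule AE_distrD[OF rng_measurable_\<nu> assms])

text \<open>Inversion carries the source map to the range map, and symmetry of the class says that
  it preserves null sets; so the claim follows from the one for ranges.\<close>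

lemma AE_src:
  assumes "AE x in r\<nu>. P x"
  shows "AE \<gamma> in \<nu>. P (src G \<gamma>)"
proof -
  have "AE \<gamma> in distr \<nu> (arrows G) (ginv G). P (rng G \<gamma>)"
    using AE_rng[OF assms] symmetric \<nu>_in equivalent_measures_AE
    unfolding symmetric_class_def by blast
  moreover have "ginv G \<in> \<nu> \<rightarrow>\<^sub>M arrows G"
    using inv_measurable by (simp cong: measurable_cong_sets)
  ultimately have "AE \<gamma> in \<nu>. P (rng G (ginv G \<gamma>))"
    by (rule AE_distrD[where P = "\<lambda>\<gamma>. P (rng G \<gamma>)", rotated])
  thus ?thesis
    using AE_space by eventually_elim (simp add: rng_inv)
qed

lemma AE_reduction: "conull_borel G C U \<Longrightarrow> AE \<gamma> in \<nu>. \<gamma> \<in> reduction G U"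
  using AE_rng[of "\<lambda>x. x \<in> U"] AE_src[of "\<lambda>x. x \<in> U"] AE_space[of \<nu>]
  unfolding conull_borel_iff reduction_def by auto

text \<open>The measure of a null set is the integral of its fibre measures; these are nonnegative,
  so almost all of them vanish.\<close>

lemma disintegration_AE:
  assumes \<kappa>: "disintegration G \<nu> \<kappa>" and P: "AE \<gamma> in \<nu>. P \<gamma>"
  shows "AE x in r\<nu>. AE \<gamma> in \<kappa> x. P \<gamma>"
proof -
  obtain N where N: "{\<gamma> \<in> space \<nu>. \<not> P \<gamma>} \<subseteq> N" "emeasure \<nu> N = 0" "N \<in> sets \<nu>"
    using P by (rule AE_E)
  have [measurable]: "\<kappa> \<in> unit_space G \<rightarrow>\<^sub>M subprob_algebra (arrows G)"
    using \<kappa> by (auto simp: disintegration_def intro: measurable_prob_algebraD)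
  have [measurable]: "N \<in> sets (arrows G)" using N by simp
  have "(\<integral>\<^sup>+x. emeasure (\<kappa> x) N \<partial>r\<nu>) = 0"
    using \<kappa> N by (simp add: disintegration_def)
  hence "AE x in r\<nu>. emeasure (\<kappa> x) N = 0"
    by (subst (asm) nn_integral_0_iff_AE) auto
  thus ?thesis
    using AE_space
  proof eventually_elim
    case (elim x)
    have "\<kappa> x \<in> space (prob_algebra (arrows G))"
      using \<kappa> elim by (intro measurable_space[of \<kappa> "unit_space G"]) (simp_all add: disintegration_def)
    hence sets: "sets (\<kappa> x) = sets (arrows G)" by (simp add: space_prob_algebra)
    show ?case
      by (rule AE_I'[of N]) (use N elim sets sets_eq_imp_space_eq[OF sets] in auto)
  qed
qed

text \<open>Quasi-invariance pulls null sets back along left multiplication by \<gamma>. The premise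
  on the range of \<eta> stays in the conclusion because the product is meaningful only
  there.\<close>

lemma equivalent_left_translate_AE:
  assumes \<gamma>: "\<gamma> \<in> space (arrows G)" and sets: "sets \<mu> = sets (arrows G)"
    and equiv: "equivalent_measures (left_translate G \<gamma> \<mu>) \<mu>'" and P: "AE \<eta> in \<mu>'. P \<eta>"
  shows "AE \<eta> in \<mu>. rng G \<eta> = src G \<gamma> \<longrightarrow> P (\<gamma> \<cdot> \<eta>)"
proof -
  let ?F = "{\<eta> \<in> space (arrows G). rng G \<eta> = src G \<gamma>}"
  have sp: "space \<mu> = space (arrows G)" using sets by (rule sets_eq_imp_space_eq)
  have F: "?F \<in> sets \<mu>" using fibre_in_sets[OF src_closed[OF \<gamma>]] sets by simp
  have "(\<lambda>\<eta>. \<gamma> \<cdot> \<eta>) \<in> restrict_space \<mu> ?F \<rightarrow>\<^sub>M arrows G"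
    using left_mult_measurable[OF \<gamma>] sets
    by (simp cong: measurable_cong_sets sets_restrict_space_cong)
  moreover have "AE \<eta> in left_translate G \<gamma> \<mu>. P \<eta>"
    using P by (simp add: equivalent_measures_AE[OF equiv])
  ultimately have "AE \<eta> in restrict_space \<mu> ?F. P (\<gamma> \<cdot> \<eta>)"
    unfolding left_translate_def by (rule AE_distrD)
  hence "AE \<eta> in \<mu>. \<eta> \<in> ?F \<longrightarrow> P (\<gamma> \<cdot> \<eta>)"
    using F by (subst (asm) AE_restrict_space_iff) (auto intro: sets.Int)
  thus ?thesis using AE_space by eventually_elim (simp add: sp)
qed

text \<open>If \<open>\<gamma>\<close> lies over good units, then by quasi-invariance \<open>\<gamma>\<eta>\<close> and \<open>\<eta>\<close> lie in \<open>S\<close> for almost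
  every \<open>\<eta>\<close> in the fibre over \<open>s(\<gamma>)\<close>, and \<open>\<gamma>\<close> is the quotient of two such elements.\<close>

lemma reduction_in_conull_set:
  assumes inv: "disintegration G \<nu> \<kappa>" "conull_borel G C U"
      "\<And>\<gamma>. \<gamma> \<in> reduction G U \<Longrightarrow>
        equivalent_measures (left_translate G \<gamma> (\<kappa> (src G \<gamma>))) (\<kappa> (rng G \<gamma>))"
    and U': "conull_borel G C U'"
    and S: "AE \<gamma> in \<nu>. \<gamma> \<in> S"
    and S_quotient: "\<And>\<gamma> \<eta>. \<lbrakk>\<gamma> \<in> reduction G U'; \<eta> \<in> reduction G U'; src G \<gamma> = rng G \<eta>;
        \<gamma> \<cdot> \<eta> \<in> S; \<eta> \<in> S\<rbrakk> \<Longrightarrow> \<gamma> \<in> S"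
  obtains V where "conull_borel G C V" "V \<subseteq> U'" "reduction G V \<subseteq> S"
proof -
  have "AE x in r\<nu>. AE \<eta> in \<kappa> x. \<eta> \<in> S \<and> \<eta> \<in> reduction G U'"
    using S AE_reduction[OF U'] by (intro disintegration_AE[OF inv(1)]) auto
  moreover have "AE x in r\<nu>. AE \<eta> in \<kappa> x. rng G \<eta> = x"
    using inv(1) by (simp add: disintegration_def)
  moreover have "AE x in r\<nu>. x \<in> U" "AE x in r\<nu>. x \<in> U'"
    using inv(2) U' by (auto simp: conull_borel_iff)
  ultimately have "AE x in r\<nu>. (AE \<eta> in \<kappa> x. \<eta> \<in> S \<and> \<eta> \<in> reduction G U') \<and>
      (AE \<eta> in \<kappa> x. rng G \<eta> = x) \<and> x \<in> U \<and> x \<in> U'"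
    by eventually_elim auto
  then obtain V where V: "V \<in> sets r\<nu>" "AE x in r\<nu>. x \<in> V"
    and V_S: "\<And>x. x \<in> V \<Longrightarrow> AE \<eta> in \<kappa> x. \<eta> \<in> S \<and> \<eta> \<in> reduction G U'"
    and V_rng: "\<And>x. x \<in> V \<Longrightarrow> AE \<eta> in \<kappa> x. rng G \<eta> = x"
    and VU: "\<And>x. x \<in> V \<Longrightarrow> x \<in> U" "\<And>x. x \<in> V \<Longrightarrow> x \<in> U'"
    by (rule AE_obtain_measurable_subset) blast
  have "\<gamma> \<in> S" if "\<gamma> \<in> reduction G V" for \<gamma>
  proof -
    have \<gamma>: "\<gamma> \<in> space (arrows G)" "rng G \<gamma> \<in> V" "src G \<gamma> \<in> V"
      using that by (auto simp: reduction_def)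
    hence \<gamma>U: "\<gamma> \<in> reduction G U" "\<gamma> \<in> reduction G U'"
      using VU by (auto simp: reduction_def)
    have "\<kappa> (src G \<gamma>) \<in> space (prob_algebra (arrows G))"
      using inv(1) \<gamma>(1) by (intro measurable_space[of \<kappa> "unit_space G"]) (simp_all add: disintegration_def)
    hence sets: "sets (\<kappa> (src G \<gamma>)) = sets (arrows G)" and prob: "prob_space (\<kappa> (src G \<gamma>))"
      by (auto simp: space_prob_algebra)
    have "AE \<eta> in \<kappa> (src G \<gamma>). rng G \<eta> = src G \<gamma> \<longrightarrow> \<gamma> \<cdot> \<eta> \<in> S"
      by (rule equivalent_left_translate_AE[OF \<gamma>(1) sets inv(3)[OF \<gamma>U(1)]])
         (use V_S[OF \<gamma>(2)] in auto)
    hence "AE \<eta> in \<kappa> (src G \<gamma>). \<gamma> \<cdot> \<eta> \<in> S \<and> \<eta> \<in> S \<and> \<eta> \<in> reduction G U' \<and> rng G \<eta> = src G \<gamma>"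
      using V_S[OF \<gamma>(3)] V_rng[OF \<gamma>(3)] by eventually_elim auto
    \<comment> \<open>Under a probability measure a property that holds almost everywhere has a
      witness, so one \<eta> meets all four conditions at once.\<close>
    then obtain \<eta> where "\<gamma> \<cdot> \<eta> \<in> S" "\<eta> \<in> S" "\<eta> \<in> reduction G U'" "rng G \<eta> = src G \<gamma>"
      using eventually_happens'[OF prob_space.ae_filter_bot[OF prob]] by blast
    thus ?thesis using S_quotient \<gamma>U(2) by simp
  qed
  thus ?thesis using that[of V] V VU by (auto simp: conull_borel_iff)
qed

end

section \<open>Borel sections: pullback, fibrewise operations, measurable selection\<close>

lemma borel_sections_carrier: "\<xi> \<in> borel_sections X \<H> \<Longrightarrow> x \<in> space X \<Longrightarrow> \<xi> x \<in> carrier (fibre \<H> x)"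
  by (simp add: borel_sections_def)

lemma borel_sections_inner:
  "\<xi> \<in> borel_sections X \<H> \<Longrightarrow> (\<lambda>x. hinner (fibre \<H> x) (\<xi> x) (fund \<H> n x)) \<in> borel_measurable X"
  by (simp add: borel_sections_def)

lemma hilbert_bundle_fibre: "hilbert_bundle X \<H> \<Longrightarrow> x \<in> space X \<Longrightarrow> complex_hilbert_space (fibre \<H> x)"
  by (simp add: hilbert_bundle_def)

lemma hilbert_bundle_fund_closed:
  "hilbert_bundle X \<H> \<Longrightarrow> x \<in> space X \<Longrightarrow> fund \<H> n x \<in> carrier (fibre \<H> x)"
  by (simp add: hilbert_bundle_def total_sequence_def)

lemma pullback_simps [simp]:
  "fibre (pullback f \<H>) y = fibre \<H> (f y)" "fund (pullback f \<H>) n y = fund \<H> n (f y)"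
  by (simp_all add: pullback_def)

lemma hilbert_bundle_pullback:
  assumes "hilbert_bundle X \<H>" and f: "f \<in> Y \<rightarrow>\<^sub>M X"
  shows "hilbert_bundle Y (pullback f \<H>)"
proof -
  have "(\<lambda>x. hinner (fibre \<H> x) (fund \<H> m x) (fund \<H> n x)) \<in> borel_measurable X" for m n
    using assms by (simp add: hilbert_bundle_def)
  from measurable_compose[OF f this] show ?thesis
    using assms(1) measurable_space[OF f] by (simp add: hilbert_bundle_def)
qed

lemma borel_sections_pullback:
  assumes "\<xi> \<in> borel_sections X \<H>" and f: "f \<in> Y \<rightarrow>\<^sub>M X"
  shows "(\<lambda>y. \<xi> (f y)) \<in> borel_sections Y (pullback f \<H>)"
  using borel_sections_carrier[OF assms(1) measurable_space[OF f]]
    measurable_compose[OF f borel_sections_inner[OF assms(1)]]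
  unfolding borel_sections_def by simp

lemma borel_sectionsI:
  assumes "\<And>x. x \<in> space X \<Longrightarrow> \<xi> x \<in> carrier (fibre \<H> x)"
    and "\<And>x n. x \<in> space X \<Longrightarrow> hinner (fibre \<H> x) (\<xi> x) (fund \<H> n x) = f n x"
    and "\<And>n. f n \<in> borel_measurable X"
  shows "\<xi> \<in> borel_sections X \<H>"
proof -
  have "(\<lambda>x. hinner (fibre \<H> x) (\<xi> x) (fund \<H> n x)) \<in> borel_measurable X" for n
    using assms(3)[of n] by (subst measurable_cong[OF assms(2)])
  thus ?thesis using assms(1) by (simp add: borel_sections_def)
qed

context
  fixes X :: "'x measure" and \<H> :: "('x, 'h) bundle_data"
  assumes hb: "hilbert_bundle X \<H>"
begin

lemma borel_sections_zero: "(\<lambda>x. \<zero>\<^bsub>fibre \<H> x\<^esub>) \<in> borel_sections X \<H>"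
proof (rule borel_sectionsI)
  fix x assume x: "x \<in> space X"
  interpret complex_hilbert_space "fibre \<H> x" by (rule hilbert_bundle_fibre[OF hb x])
  show "\<zero>\<^bsub>fibre \<H> x\<^esub> \<in> carrier (fibre \<H> x)" by simp
  show "hinner (fibre \<H> x) \<zero>\<^bsub>fibre \<H> x\<^esub> (fund \<H> n x) = 0" for n
    by (simp add: hilbert_bundle_fund_closed[OF hb x])
qed simp

lemma borel_sections_add:
  assumes \<xi>: "\<xi> \<in> borel_sections X \<H>" and \<eta>: "\<eta> \<in> borel_sections X \<H>"
  shows "(\<lambda>x. \<xi> x \<oplus>\<^bsub>fibre \<H> x\<^esub> \<eta> x) \<in> borel_sections X \<H>"
proof (rule borel_sectionsI)
  fix x assume x: "x \<in> space X"
  interpret complex_hilbert_space "fibre \<H> x" by (rule hilbert_bundle_fibre[OF hb x])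
  note c = borel_sections_carrier[OF \<xi> x] borel_sections_carrier[OF \<eta> x] hilbert_bundle_fund_closed[OF hb x]
  show "\<xi> x \<oplus>\<^bsub>fibre \<H> x\<^esub> \<eta> x \<in> carrier (fibre \<H> x)" using c by simp
  show "hinner (fibre \<H> x) (\<xi> x \<oplus>\<^bsub>fibre \<H> x\<^esub> \<eta> x) (fund \<H> n x) =
      hinner (fibre \<H> x) (\<xi> x) (fund \<H> n x) + hinner (fibre \<H> x) (\<eta> x) (fund \<H> n x)" for n
    by (rule inner_add) (rule c)+
qed (intro borel_measurable_add borel_sections_inner \<xi> \<eta>)

lemma borel_sections_minus:
  assumes \<xi>: "\<xi> \<in> borel_sections X \<H>" and \<eta>: "\<eta> \<in> borel_sections X \<H>"
  shows "(\<lambda>x. \<xi> x \<ominus>\<^bsub>fibre \<H> x\<^esub> \<eta> x) \<in> borel_sections X \<H>"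
proof (rule borel_sectionsI)
  fix x assume x: "x \<in> space X"
  interpret complex_hilbert_space "fibre \<H> x" by (rule hilbert_bundle_fibre[OF hb x])
  note c = borel_sections_carrier[OF \<xi> x] borel_sections_carrier[OF \<eta> x] hilbert_bundle_fund_closed[OF hb x]
  show "\<xi> x \<ominus>\<^bsub>fibre \<H> x\<^esub> \<eta> x \<in> carrier (fibre \<H> x)" using c by simp
  show "hinner (fibre \<H> x) (\<xi> x \<ominus>\<^bsub>fibre \<H> x\<^esub> \<eta> x) (fund \<H> n x) =
      hinner (fibre \<H> x) (\<xi> x) (fund \<H> n x) - hinner (fibre \<H> x) (\<eta> x) (fund \<H> n x)" for n
    by (rule inner_minus) (rule c)+
qed (intro borel_measurable_diff borel_sections_inner \<xi> \<eta>)

text \<open>The index \<open>m\<close> is Borel, as the least index satisfying a sequence of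
  measurable conditions, and has countably many values, so the section is Borel piece by piece.
  Where every member vanishes, \<open>m\<close> is some unspecified index, but the norm there is 0
  and \<open>1 / 0 = 0\<close>, so the section is zero at such a point.\<close>

lemma borel_sections_first_nonzero:
  fixes \<zeta> :: "nat \<Rightarrow> 'x \<Rightarrow> 'h"
  assumes \<zeta>: "\<And>k. \<zeta> k \<in> borel_sections X \<H>"
  defines "m \<equiv> \<lambda>x. LEAST k. hnorm (fibre \<H> x) (\<zeta> k x) \<noteq> 0"
  shows "(\<lambda>x. complex_of_real (1 / hnorm (fibre \<H> x) (\<zeta> (m x) x)) \<odot>\<^bsub>fibre \<H> x\<^esub> \<zeta> (m x) x)
    \<in> borel_sections X \<H>"
proof (rule borel_sectionsI)
  fix x assume x: "x \<in> space X"
  interpret complex_hilbert_space "fibre \<H> x" by (rule hilbert_bundle_fibre[OF hb x])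
  note c = borel_sections_carrier[OF \<zeta> x] hilbert_bundle_fund_closed[OF hb x]
  show "complex_of_real (1 / hnorm (fibre \<H> x) (\<zeta> (m x) x)) \<odot>\<^bsub>fibre \<H> x\<^esub> \<zeta> (m x) x \<in> carrier (fibre \<H> x)"
    using c by simp
  show "hinner (fibre \<H> x) (complex_of_real (1 / hnorm (fibre \<H> x) (\<zeta> (m x) x)) \<odot>\<^bsub>fibre \<H> x\<^esub> \<zeta> (m x) x)
      (fund \<H> n x) = complex_of_real (1 / hnorm (fibre \<H> x) (\<zeta> (m x) x)) *
      hinner (fibre \<H> x) (\<zeta> (m x) x) (fund \<H> n x)" for n
    by (rule inner_smult) (rule c)+
next
  fix n
  have [measurable]: "(\<lambda>x. hnorm (fibre \<H> x) (\<zeta> k x)) \<in> borel_measurable X" for k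
    by (rule borel_measurable_hnorm[OF hb \<zeta>])
  have [measurable]: "m \<in> X \<rightarrow>\<^sub>M count_space UNIV"
    unfolding m_def by measurable
  have [measurable]: "(\<lambda>x. hinner (fibre \<H> x) (\<zeta> k x) (fund \<H> n x)) \<in> borel_measurable X" for k
    by (rule borel_sections_inner[OF \<zeta>])
  have "(\<lambda>x. complex_of_real (1 / hnorm (fibre \<H> x) (\<zeta> k x)) *
      hinner (fibre \<H> x) (\<zeta> k x) (fund \<H> n x)) \<in> borel_measurable X" for k
    by measurable
  thus "(\<lambda>x. complex_of_real (1 / hnorm (fibre \<H> x) (\<zeta> (m x) x)) *
      hinner (fibre \<H> x) (\<zeta> (m x) x) (fund \<H> n x)) \<in> borel_measurable X"
    by (rule measurable_compose_countable[where g = m]) measurable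
qed

end

section \<open>Countable multiples of bundles and of their isomorphisms\<close>

definition ell2_bundle :: "('x, vec) bundle_data \<Rightarrow> ('x, vec) bundle_data" where
  "ell2_bundle \<H> =
    \<lparr>fibre = (\<lambda>x. ell2 (fibre \<H> x)),
     fund = (\<lambda>n x. ell2_fund (fibre \<H> x) (\<lambda>k. fund \<H> k x) n)\<rparr>"

lemma ell2_bundle_simps [simp]:
  "fibre (ell2_bundle \<H>) x = ell2 (fibre \<H> x)"
  "fund (ell2_bundle \<H>) n x = ell2_fund (fibre \<H> x) (\<lambda>k. fund \<H> k x) n"
  by (simp_all add: ell2_bundle_def)

lemma pullback_ell2_bundle: "pullback f (ell2_bundle \<H>) = ell2_bundle (pullback f \<H>)"
  by (simp add: pullback_def ell2_bundle_def)

lemma hilbert_bundle_multiple: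
  "hilbert_bundle X \<H> \<Longrightarrow> x \<in> space X \<Longrightarrow> hilbert_multiple (fibre \<H> x)"
  by (simp add: hilbert_multiple_def hilbert_bundle_fibre)

lemma hinner_ell2_fund:
  assumes "hilbert_bundle X \<H>" "x \<in> space X" "f \<in> carrier (ell2 (fibre \<H> x))"
  shows "hinner (ell2 (fibre \<H> x)) f (fund (ell2_bundle \<H>) n x) =
    (case prod_decode n of (k, i) \<Rightarrow> hinner (fibre \<H> x) (ell2_nth k f) (fund \<H> i x))"
  using hilbert_multiple.hinner_ell2_single[OF hilbert_bundle_multiple[OF assms(1,2)] assms(3)]
    hilbert_bundle_fund_closed[OF assms(1,2)]
  by (simp add: ell2_fund_def split: prod.split)

lemma hilbert_bundle_ell2:
  assumes "hilbert_bundle X \<H>"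
  shows "hilbert_bundle X (ell2_bundle \<H>)"
  unfolding hilbert_bundle_def
proof (intro conjI ballI allI)
  fix x assume x: "x \<in> space X"
  interpret hilbert_multiple "fibre \<H> x" by (rule hilbert_bundle_multiple[OF assms x])
  show "complex_hilbert_space (fibre (ell2_bundle \<H>) x)"
    by (simp add: complex_hilbert_space_ell2)
  show "total_sequence (fibre (ell2_bundle \<H>) x) (\<lambda>n. fund (ell2_bundle \<H>) n x)"
    using total_sequence_ell2 assms x by (simp add: hilbert_bundle_def)
next
  fix m n
  obtain k i where ki: "prod_decode n = (k, i)" by fastforce
  obtain l j where lj: "prod_decode m = (l, j)" by fastforce
  have "(\<lambda>x. if k = l then hinner (fibre \<H> x) (fund \<H> j x) (fund \<H> i x) else 0) \<in> borel_measurable X"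
    using assms by (cases "k = l") (simp_all add: hilbert_bundle_def)
  moreover have "hinner (fibre (ell2_bundle \<H>) x) (fund (ell2_bundle \<H>) m x) (fund (ell2_bundle \<H>) n x) =
      (if k = l then hinner (fibre \<H> x) (fund \<H> j x) (fund \<H> i x) else 0)" if x: "x \<in> space X" for x
  proof -
    interpret hilbert_multiple "fibre \<H> x" by (rule hilbert_bundle_multiple[OF assms x])
    note w = hilbert_bundle_fund_closed[OF assms x]
    have "ell2_nth k (ell2_single (fibre \<H> x) l v) = (if k = l then v else \<zero>\<^bsub>fibre \<H> x\<^esub>)" for v
      by (simp add: ell2_single_def)
    thus ?thesis
      using w by (simp add: ki lj ell2_fund_def hinner_ell2_single ell2_single_closed)
  qed
  ultimately show "(\<lambda>x. hinner (fibre (ell2_bundle \<H>) x) (fund (ell2_bundle \<H>) m x) (fund (ell2_bundle \<H>) n x))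
      \<in> borel_measurable X"
    by (simp cong: measurable_cong)
qed

lemma all_prod_decode: "(\<forall>n. Q (prod_decode n)) \<longleftrightarrow> (\<forall>k i. Q (k, i))"
  by (metis prod_encode_inverse surj_pair)

text \<open>The inner product with the fundamental vector of index (k, i) is the i-th coefficient of
  the k-th component, so measurability can be checked one component at a time. Membership in the
  fibre has to be required separately, since it includes square-summability.\<close>

lemma borel_sections_ell2_iff:
  assumes "hilbert_bundle X \<H>"
  shows "F \<in> borel_sections X (ell2_bundle \<H>) \<longleftrightarrow>
    (\<forall>x\<in>space X. F x \<in> carrier (ell2 (fibre \<H> x))) \<and>
    (\<forall>k. (\<lambda>x. ell2_nth k (F x)) \<in> borel_sections X \<H>)" (is "?L \<longleftrightarrow> ?C \<and> ?R")
proof (cases ?C)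
  case True
  have "?L \<longleftrightarrow> (\<forall>n. (\<lambda>x. case prod_decode n of (k, i) \<Rightarrow>
      hinner (fibre \<H> x) (ell2_nth k (F x)) (fund \<H> i x)) \<in> borel_measurable X)"
    using True hinner_ell2_fund[OF assms]
    by (simp add: borel_sections_def del: ell2_bundle_simps(2) cong: measurable_cong)
  also have "\<dots> \<longleftrightarrow> (\<forall>k i. (\<lambda>x. hinner (fibre \<H> x) (ell2_nth k (F x)) (fund \<H> i x)) \<in> borel_measurable X)"
    using all_prod_decode[of "\<lambda>p. (\<lambda>x. hinner (fibre \<H> x) (ell2_nth (fst p) (F x)) (fund \<H> (snd p) x))
      \<in> borel_measurable X"] by (simp only: case_prod_unfold fst_conv snd_conv)
  also have "\<dots> \<longleftrightarrow> ?R"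
    using True by (simp add: borel_sections_def)
  finally show ?thesis using True by simp
qed (auto simp: borel_sections_def)

definition ell2_map :: "(vec \<Rightarrow> vec) \<Rightarrow> vec \<Rightarrow> vec" where
  "ell2_map T f = ell2_pack (\<lambda>n. T (ell2_nth n f))"

lemma ell2_nth_map [simp]: "ell2_nth n (ell2_map T f) = T (ell2_nth n f)"
  by (simp add: ell2_map_def)

context
  fixes H K :: "'h hilbert" and T :: "'h \<Rightarrow> 'h"
  assumes iso: "hilbert_isomorphism H K T"
begin

lemma hilbert_isomorphism_closed: "v \<in> carrier H \<Longrightarrow> T v \<in> carrier K"
  using iso by (auto simp: hilbert_isomorphism_def bij_betw_def)

lemma hilbert_isomorphism_hnorm: "v \<in> carrier H \<Longrightarrow> hnorm K (T v) = hnorm H v"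
  using iso by (simp add: hilbert_isomorphism_def hnorm_def)

lemma hilbert_isomorphism_add: "u \<in> carrier H \<Longrightarrow> v \<in> carrier H \<Longrightarrow> T (u \<oplus>\<^bsub>H\<^esub> v) = T u \<oplus>\<^bsub>K\<^esub> T v"
  using iso by (simp add: hilbert_isomorphism_def)

lemma hilbert_isomorphism_smult: "v \<in> carrier H \<Longrightarrow> T (c \<odot>\<^bsub>H\<^esub> v) = c \<odot>\<^bsub>K\<^esub> T v"
  using iso by (simp add: hilbert_isomorphism_def)

context
  assumes H: "complex_hilbert_space H" and K: "complex_hilbert_space K"
begin

interpretation H: complex_hilbert_space H by (rule H)
interpretation K: complex_hilbert_space K by (rule K)

lemma hilbert_isomorphism_zero: "T \<zero>\<^bsub>H\<^esub> = \<zero>\<^bsub>K\<^esub>"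
  using hilbert_isomorphism_smult[of "\<zero>\<^bsub>H\<^esub>" 0] hilbert_isomorphism_closed[of "\<zero>\<^bsub>H\<^esub>"] by simp

lemma hilbert_isomorphism_minus:
  assumes "u \<in> carrier H" "v \<in> carrier H"
  shows "T (u \<ominus>\<^bsub>H\<^esub> v) = T u \<ominus>\<^bsub>K\<^esub> T v"
  using assms hilbert_isomorphism_closed
  by (simp add: a_minus_def hilbert_isomorphism_add hilbert_isomorphism_smult
      flip: H.smult_minus_one K.smult_minus_one)

end

end

lemma hilbert_isomorphism_ell2:
  assumes iso: "hilbert_isomorphism H K T"
  shows "hilbert_isomorphism (ell2 H) (ell2 K) (ell2_map T)"
  unfolding hilbert_isomorphism_def
proof (intro conjI ballI allI)
  note closed = hilbert_isomorphism_closed[OF iso] and norm = hilbert_isomorphism_hnorm[OF iso]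
  have map_closed: "ell2_map T f \<in> carrier (ell2 K)" if "f \<in> carrier (ell2 H)" for f
    using that closed norm by (simp add: ell2_carrier_iff)
  show "bij_betw (ell2_map T) (carrier (ell2 H)) (carrier (ell2 K))"
  proof (rule bij_betw_imageI)
    show "inj_on (ell2_map T) (carrier (ell2 H))"
    proof (rule inj_onI, rule ell2_eqI)
      fix f g n assume fg: "f \<in> carrier (ell2 H)" "g \<in> carrier (ell2 H)" "ell2_map T f = ell2_map T g"
      hence "T (ell2_nth n f) = T (ell2_nth n g)" by (metis ell2_nth_map)
      thus "ell2_nth n f = ell2_nth n g"
        using iso fg(1,2) by (auto simp: hilbert_isomorphism_def bij_betw_def inj_on_def)
    qed
    have "T ` carrier H = carrier K"
      using iso by (simp add: hilbert_isomorphism_def bij_betw_def)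
    hence preimage: "\<exists>v\<in>carrier H. T v = w" if "w \<in> carrier K" for w
      using that by (metis imageE)
    have "g \<in> ell2_map T ` carrier (ell2 H)" if g: "g \<in> carrier (ell2 K)" for g
    proof -
      have "\<exists>v\<in>carrier H. T v = ell2_nth n g" for n
        using g by (intro preimage) simp
      then obtain v where v: "\<And>n. v n \<in> carrier H" "\<And>n. T (v n) = ell2_nth n g" by metis
      \<comment> \<open>The componentwise preimage of a square-summable sequence is square-summable
        because \<open>T\<close> preserves norms; this gives surjectivity.\<close>
      have "hnorm H (v n) = hnorm K (ell2_nth n g)" for n
        using norm[OF v(1)] v(2) by metis
      hence "ell2_pack v \<in> carrier (ell2 H)"
        using g v(1) by (simp add: ell2_carrier_iff)
      moreover have "g = ell2_map T (ell2_pack v)"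
        by (rule ell2_eqI) (simp add: v(2))
      ultimately show ?thesis by blast
    qed
    thus "ell2_map T ` carrier (ell2 H) = carrier (ell2 K)"
      using map_closed by blast
  qed
  fix f g assume f: "f \<in> carrier (ell2 H)" and g: "g \<in> carrier (ell2 H)"
  show "ell2_map T (f \<oplus>\<^bsub>ell2 H\<^esub> g) = ell2_map T f \<oplus>\<^bsub>ell2 K\<^esub> ell2_map T g"
    by (rule ell2_eqI) (use f g in \<open>simp add: hilbert_isomorphism_add[OF iso]\<close>)
  show "hinner (ell2 K) (ell2_map T f) (ell2_map T g) = hinner (ell2 H) f g"
    using f g iso by (simp add: hinner_ell2 hilbert_isomorphism_def)
next
  fix c f assume f: "f \<in> carrier (ell2 H)"
  show "ell2_map T (c \<odot>\<^bsub>ell2 H\<^esub> f) = c \<odot>\<^bsub>ell2 K\<^esub> ell2_map T f"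
    by (rule ell2_eqI) (use f in \<open>simp add: hilbert_isomorphism_smult[OF iso]\<close>)
qed

section \<open>Coboundaries and square-summable cocycles\<close>

text \<open>Dominated convergence of indicators turns almost sure convergence into convergence in
  probability. Choose \<open>r k\<close> so that the value exceeds \<open>(1/2)^k\<close> with
  probability below \<open>(1/2)^k\<close>; by Borel-Cantelli the squares are almost surely
  eventually at most \<open>(1/4)^k\<close>. Only summability is wanted, so \<open>r\<close> is not
  made increasing.\<close>

lemma (in prob_space) AE_summable_subsequence:
  fixes f :: "nat \<Rightarrow> 'a \<Rightarrow> real"
  assumes [measurable]: "\<And>n. f n \<in> borel_measurable M"
    and lim: "AE x in M. (\<lambda>n. f n x) \<longlonglongrightarrow> 0"
  shows "\<exists>r. AE x in M. summable (\<lambda>k. (f (r k) x)\<^sup>2)"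
proof -
  define A where "A n k = {x \<in> space M. (1 / 2) ^ k < \<bar>f n x\<bar>}" for n k :: nat
  have A [measurable]: "A n k \<in> sets M" for n k
    unfolding A_def by measurable
  have A_lim: "(\<lambda>n. prob (A n k)) \<longlonglongrightarrow> 0" for k
  proof -
    have "(\<lambda>n. \<integral>x. (indicator (A n k) x :: real) \<partial>M) \<longlonglongrightarrow> (\<integral>x. 0 \<partial>M)"
    proof (rule integral_dominated_convergence[where w = "\<lambda>_. 1 :: real"])
      show "AE x in M. (\<lambda>n. indicator (A n k) x :: real) \<longlonglongrightarrow> 0"
        using lim
      proof eventually_elim
        case (elim x)
        have "(\<lambda>n. \<bar>f n x\<bar>) \<longlonglongrightarrow> 0" using tendsto_rabs[OF elim] by simp
        hence "\<forall>\<^sub>F n in sequentially. \<bar>f n x\<bar> < (1 / 2) ^ k"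
          by (rule order_tendstoD(2)) simp
        hence "\<forall>\<^sub>F n in sequentially. indicator (A n k) x = (0 :: real)"
          by eventually_elim (simp add: A_def)
        thus ?case by (rule tendsto_eventually)
      qed
    qed (auto simp: indicator_def)
    thus ?thesis by simp
  qed
  have "\<exists>n. prob (A n k) < (1 / 2) ^ k" for k
  proof -
    have "\<forall>\<^sub>F n in sequentially. prob (A n k) < (1 / 2) ^ k"
      using A_lim by (rule order_tendstoD(2)) simp
    thus ?thesis by (rule eventually_happens'[OF sequentially_bot])
  qed
  then obtain r where r: "\<And>k. prob (A (r k) k) < (1 / 2) ^ k" by metis
  have "summable (\<lambda>k. prob (A (r k) k))"
    by (rule summable_comparison_test'[where g = "\<lambda>k. (1 / 2) ^ k" and N = 0])
       (use r in \<open>auto simp: less_imp_le\<close>)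
  hence "AE x in M. \<forall>\<^sub>F k in sequentially. x \<in> space M - A (r k) k"
    by (intro borel_cantelli_AE1) (auto simp: less_top[symmetric])
  hence "AE x in M. summable (\<lambda>k. (f (r k) x)\<^sup>2)"
  proof eventually_elim
    case (elim x)
    have "\<forall>\<^sub>F k in sequentially. norm ((f (r k) x)\<^sup>2) \<le> (1 / 4) ^ k"
      using elim
    proof eventually_elim
      case (elim k)
      hence "\<bar>f (r k) x\<bar>\<^sup>2 \<le> ((1 / 2) ^ k)\<^sup>2"
        by (intro power_mono) (auto simp: A_def)
      also have "\<dots> = ((1 / 2)\<^sup>2) ^ k" by (simp only: power_mult[symmetric] mult.commute)
      finally show ?case by (simp add: power2_eq_square)
    qed
    thus ?case by (rule summable_comparison_test_ev) (simp add: summable_geometric)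
  qed
  thus ?thesis by blast
qed

text \<open>With \<open>a\<close>, \<open>c\<close> the values of two sections at the range of an
  arrow and \<open>b\<close>, \<open>d\<close> their transported values from the source: if the
  coboundaries are opposite, then the sum of the sections is invariant along the arrow. The
  subtraction from zero matches the form in which the zero class delivers its coboundary.\<close>

lemma (in complex_hilbert_space) cobound_opposite:
  assumes "a \<in> carrier H" "b \<in> carrier H" "c \<in> carrier H" "d \<in> carrier H"
    and eq: "\<zero> \<ominus> (a \<ominus> b) = c \<ominus> d"
  shows "a \<oplus> c = b \<oplus> d"
proof -
  have "c = (c \<ominus> d) \<oplus> d"
    using assms(3,4) by (simp add: a_minus_def a_assoc l_neg)
  also have "c \<ominus> d = b \<ominus> a"
    using assms(1,2) unfolding eq[symmetric] by (simp add: a_minus_def minus_add a_comm)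
  finally have "a \<oplus> c = a \<oplus> ((b \<ominus> a) \<oplus> d)" by simp
  also have "\<dots> = (a \<oplus> \<ominus> a) \<oplus> (b \<oplus> d)"
    using assms(1-4) by (simp only: a_minus_def a_ac add.m_closed a_inv_closed)
  finally show ?thesis using assms(1-4) by (simp add: r_neg)
qed

definition cobound ::
    "'g groupoid \<Rightarrow> ('g, 'h) bundle_data \<Rightarrow> ('g \<Rightarrow> 'h \<Rightarrow> 'h) \<Rightarrow> ('g \<Rightarrow> 'h) \<Rightarrow> 'g \<Rightarrow> 'h" where
  "cobound G \<H> L \<xi> \<gamma> = \<xi> (rng G \<gamma>) \<ominus>\<^bsub>fibre \<H> (rng G \<gamma>)\<^esub> L \<gamma> (\<xi> (src G \<gamma>))"

locale measured_representation = measured_groupoid_with_prob +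
  fixes \<H> :: "('a, 'h) bundle_data" and L :: "'a \<Rightarrow> 'h \<Rightarrow> 'h"
  assumes hilbert: "hilbert_bundle (unit_space G) \<H>" and rep: "representation G C \<H> L"
begin

abbreviation "\<delta> \<equiv> cobound G \<H> L"

lemma L_iso: "\<gamma> \<in> space (arrows G) \<Longrightarrow>
    hilbert_isomorphism (fibre \<H> (src G \<gamma>)) (fibre \<H> (rng G \<gamma>)) (L \<gamma>)"
  using rep by (simp add: representation_def)

lemma L_sections: "\<xi> \<in> borel_sections (unit_space G) \<H> \<Longrightarrow>
    (\<lambda>\<gamma>. L \<gamma> (\<xi> (src G \<gamma>))) \<in> borel_sections (arrows G) (pullback (rng G) \<H>)"
  using rep by (simp add: representation_def)

lemma L_closed: "\<gamma> \<in> space (arrows G) \<Longrightarrow> v \<in> carrier (fibre \<H> (src G \<gamma>)) \<Longrightarrow>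
    L \<gamma> v \<in> carrier (fibre \<H> (rng G \<gamma>))"
  by (rule hilbert_isomorphism_closed[OF L_iso])

lemma fibre_rng: "\<gamma> \<in> space (arrows G) \<Longrightarrow> complex_hilbert_space (fibre \<H> (rng G \<gamma>))"
  by (rule hilbert_bundle_fibre[OF hilbert rng_in_unit_space])

lemma fibre_src: "\<gamma> \<in> space (arrows G) \<Longrightarrow> complex_hilbert_space (fibre \<H> (src G \<gamma>))"
  by (rule hilbert_bundle_fibre[OF hilbert src_in_unit_space])

lemma hilbert_pullback: "hilbert_bundle (arrows G) (pullback (rng G) \<H>)"
  by (rule hilbert_bundle_pullback[OF hilbert rng_measurable_unit])

lemma cobound_sections:
  assumes "\<xi> \<in> borel_sections (unit_space G) \<H>"
  shows "\<delta> \<xi> \<in> borel_sections (arrows G) (pullback (rng G) \<H>)"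
  using borel_sections_minus[OF hilbert_pullback
      borel_sections_pullback[OF assms rng_measurable_unit] L_sections[OF assms]]
  unfolding cobound_def pullback_simps .

lemma cobound_closed:
  assumes "\<xi> \<in> borel_sections (unit_space G) \<H>" "\<gamma> \<in> space (arrows G)"
  shows "\<delta> \<xi> \<gamma> \<in> carrier (fibre \<H> (rng G \<gamma>))"
  using borel_sections_carrier[OF cobound_sections[OF assms(1)] assms(2)] by simp

text \<open>Telescoping through the value of \<xi> at the common unit, carried over by
  \<open>L \<gamma>\<close>. Multiplicativity is assumed only for the given pair because
  \<open>L\<close> has it only on an inessential reduction.\<close>

lemma cobound_mult:
  assumes \<xi>: "\<xi> \<in> borel_sections (unit_space G) \<H>"
    and \<gamma>: "\<gamma> \<in> space (arrows G)" and \<eta>: "\<eta> \<in> space (arrows G)" and comp: "src G \<gamma> = rng G \<eta>"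
    and mult: "\<And>v. v \<in> carrier (fibre \<H> (src G \<eta>)) \<Longrightarrow> L (\<gamma> \<cdot> \<eta>) v = L \<gamma> (L \<eta> v)"
  shows "\<delta> \<xi> (\<gamma> \<cdot> \<eta>) = \<delta> \<xi> \<gamma> \<oplus>\<^bsub>fibre \<H> (rng G \<gamma>)\<^esub> L \<gamma> (\<delta> \<xi> \<eta>)"
proof -
  interpret K: complex_hilbert_space "fibre \<H> (rng G \<gamma>)" by (rule fibre_rng[OF \<gamma>])
  note \<xi>c = borel_sections_carrier[OF \<xi>]
  have a: "\<xi> (rng G \<gamma>) \<in> carrier (fibre \<H> (rng G \<gamma>))"
    and b: "\<xi> (src G \<gamma>) \<in> carrier (fibre \<H> (src G \<gamma>))"
    and c: "\<xi> (src G \<eta>) \<in> carrier (fibre \<H> (src G \<eta>))"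
    by (rule \<xi>c, rule rng_in_unit_space src_in_unit_space, rule \<gamma> \<eta>)+
  have d: "L \<eta> (\<xi> (src G \<eta>)) \<in> carrier (fibre \<H> (src G \<gamma>))"
    using L_closed[OF \<eta> c] by (simp only: comp)
  have "\<delta> \<xi> (\<gamma> \<cdot> \<eta>) = \<xi> (rng G \<gamma>) \<ominus>\<^bsub>fibre \<H> (rng G \<gamma>)\<^esub> L \<gamma> (L \<eta> (\<xi> (src G \<eta>)))"
    by (simp only: cobound_def rng_mult[OF \<gamma> \<eta> comp] src_mult[OF \<gamma> \<eta> comp] mult[OF c])
  also have "\<dots> = \<delta> \<xi> \<gamma> \<oplus>\<^bsub>fibre \<H> (rng G \<gamma>)\<^esub>
      (L \<gamma> (\<xi> (src G \<gamma>)) \<ominus>\<^bsub>fibre \<H> (rng G \<gamma>)\<^esub> L \<gamma> (L \<eta> (\<xi> (src G \<eta>))))"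
    unfolding cobound_def by (intro K.minus_via a L_closed \<gamma> b d)
  also have "L \<gamma> (\<xi> (src G \<gamma>)) \<ominus>\<^bsub>fibre \<H> (rng G \<gamma>)\<^esub> L \<gamma> (L \<eta> (\<xi> (src G \<eta>))) = L \<gamma> (\<delta> \<xi> \<eta>)"
    using hilbert_isomorphism_minus[OF L_iso[OF \<gamma>] fibre_src[OF \<gamma>] fibre_rng[OF \<gamma>] b d]
    by (simp only: cobound_def comp)
  finally show ?thesis .
qed

text \<open>The class of \<open>b\<close> equals the zero class, but to conclude that
  \<open>b\<close> lies in it one needs \<open>b\<close> to be related to itself; this holds because
  the zero section has zero coboundary. The zero class consists of the cocycles to which the zero
  cocycle is related, whence the sign: the negative of \<open>b\<close> is a coboundary.\<close>

lemma H1_zero_imp_coboundary: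
  assumes H1: "H1 G C \<H> L = {H1_zero G C \<H> L}" and b: "b \<in> cocycles G C \<H> L"
  obtains \<eta> where "\<eta> \<in> borel_sections (unit_space G) \<H>"
    "AE \<gamma> in \<nu>. \<zero>\<^bsub>fibre \<H> (rng G \<gamma>)\<^esub> \<ominus>\<^bsub>fibre \<H> (rng G \<gamma>)\<^esub> b \<gamma> = \<delta> \<eta> \<gamma>"
proof -
  let ?z = "\<lambda>x. \<zero>\<^bsub>fibre \<H> x\<^esub>"
  have b_sec: "b \<in> borel_sections (arrows G) (pullback (rng G) \<H>)"
    using b by (simp add: cocycles_def)
  have "b \<gamma> \<ominus>\<^bsub>fibre \<H> (rng G \<gamma>)\<^esub> b \<gamma> = \<delta> ?z \<gamma>" if \<gamma>: "\<gamma> \<in> space (arrows G)" for \<gamma>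
  proof -
    interpret K: complex_hilbert_space "fibre \<H> (rng G \<gamma>)" by (rule fibre_rng[OF \<gamma>])
    have "b \<gamma> \<in> carrier (fibre \<H> (rng G \<gamma>))"
      using borel_sections_carrier[OF b_sec \<gamma>] by simp
    thus ?thesis
      by (simp add: cobound_def hilbert_isomorphism_zero[OF L_iso fibre_src fibre_rng] \<gamma> K.minus_eq_0_iff[THEN iffD2])
  qed
  hence "AE \<gamma> in \<nu>. b \<gamma> \<ominus>\<^bsub>fibre \<H> (rng G \<gamma>)\<^esub> b \<gamma> = \<delta> ?z \<gamma>"
    by (intro AE_I2) simp
  hence "coboundary G C \<H> L (\<lambda>\<gamma>. b \<gamma> \<ominus>\<^bsub>fibre \<H> (rng G \<gamma>)\<^esub> b \<gamma>)"
    unfolding coboundary_def AE_C_iff cobound_def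
    by (rule bexI[OF _ borel_sections_zero[OF hilbert]])
  hence "(b, b) \<in> cohomologous G C \<H> L"
    using b by (simp add: cohomologous_def)
  moreover have "cohomologous G C \<H> L `` {b} \<in> H1 G C \<H> L"
    using b by (simp add: H1_def quotientI)
  hence "cohomologous G C \<H> L `` {b} = H1_zero G C \<H> L"
    using H1 by simp
  ultimately have "b \<in> H1_zero G C \<H> L" by blast
  hence "coboundary G C \<H> L (\<lambda>\<gamma>. \<zero>\<^bsub>fibre \<H> (rng G \<gamma>)\<^esub> \<ominus>\<^bsub>fibre \<H> (rng G \<gamma>)\<^esub> b \<gamma>)"
    by (simp add: H1_zero_def cohomologous_def)
  thus ?thesis
    using that unfolding coboundary_def AE_C_iff cobound_def by blast
qed

text \<open>The first nonvanishing member of a sequence of invariant sections, normalised, is again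
  invariant because the norms are.\<close>

lemma invariant_sections_imp_unit_invariant:
  fixes \<zeta> :: "nat \<Rightarrow> 'a \<Rightarrow> 'h"
  assumes \<zeta>: "\<And>k. \<zeta> k \<in> borel_sections (unit_space G) \<H>"
    and inv: "\<And>k. AE \<gamma> in \<nu>. \<zeta> k (rng G \<gamma>) = L \<gamma> (\<zeta> k (src G \<gamma>))"
    and nonzero: "AE x in r\<nu>. \<exists>k. hnorm (fibre \<H> x) (\<zeta> k x) \<noteq> 0"
  shows "contains_unit_invariant_section G C \<H> L"
proof -
  define m where "m x = (LEAST k. hnorm (fibre \<H> x) (\<zeta> k x) \<noteq> 0)" for x
  define \<xi> where "\<xi> x = complex_of_real (1 / hnorm (fibre \<H> x) (\<zeta> (m x) x)) \<odot>\<^bsub>fibre \<H> x\<^esub> \<zeta> (m x) x" for x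
  have \<xi>_sec: "\<xi> \<in> borel_sections (unit_space G) \<H>"
    using borel_sections_first_nonzero[OF hilbert \<zeta>] unfolding \<xi>_def m_def .
  have "AE x in r\<nu>. hnorm (fibre \<H> x) (\<xi> x) = 1"
    using nonzero AE_space
  proof eventually_elim
    case (elim x)
    hence x: "x \<in> space (unit_space G)" by simp
    interpret complex_hilbert_space "fibre \<H> x" by (rule hilbert_bundle_fibre[OF hilbert x])
    have "hnorm (fibre \<H> x) (\<zeta> (m x) x) \<noteq> 0"
      unfolding m_def using elim(1) by (rule LeastI_ex)
    thus ?case
      using borel_sections_carrier[OF \<zeta> x] hnorm_nonneg[OF complex_hilbert_space_axioms borel_sections_carrier[OF \<zeta> x]]
      by (simp add: \<xi>_def hnorm_smult norm_divide del: hnorm_eq_0_iff of_real_divide)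
  qed
  moreover have "AE \<gamma> in \<nu>. \<forall>k. \<zeta> k (rng G \<gamma>) = L \<gamma> (\<zeta> k (src G \<gamma>))"
    using inv by (simp add: AE_all_countable)
  hence "AE \<gamma> in \<nu>. \<xi> (rng G \<gamma>) = L \<gamma> (\<xi> (src G \<gamma>))"
    using AE_space
  proof eventually_elim
    case (elim \<gamma>)
    hence \<gamma>: "\<gamma> \<in> space (arrows G)" by simp
    note c = borel_sections_carrier[OF \<zeta> src_in_unit_space[OF \<gamma>]]
    have norm: "hnorm (fibre \<H> (rng G \<gamma>)) (\<zeta> k (rng G \<gamma>)) = hnorm (fibre \<H> (src G \<gamma>)) (\<zeta> k (src G \<gamma>))" for k
      using elim(1) hilbert_isomorphism_hnorm[OF L_iso[OF \<gamma>] c] by simp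
    have m: "m (rng G \<gamma>) = m (src G \<gamma>)"
      unfolding m_def norm ..
    show ?case
      unfolding \<xi>_def m norm hilbert_isomorphism_smult[OF L_iso[OF \<gamma>] c] using elim(1) by simp
  qed
  ultimately show ?thesis
    unfolding contains_unit_invariant_section_def unit_section_def AE_C_iff AE_unit_class_iff
    using \<xi>_sec by blast
qed

end

lemma representation_ell2:
  assumes hb: "hilbert_bundle (unit_space G) \<H>" and rep: "representation G C \<H> L"
    and G: "borel_groupoid G"
  shows "representation G C (ell2_bundle \<H>) (\<lambda>\<gamma>. ell2_map (L \<gamma>))"
proof -
  interpret borel_groupoid G by (rule G)
  have iso: "\<And>\<gamma>. \<gamma> \<in> space (arrows G) \<Longrightarrow>
      hilbert_isomorphism (fibre \<H> (src G \<gamma>)) (fibre \<H> (rng G \<gamma>)) (L \<gamma>)"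
    using rep by (simp add: representation_def)
  have L_sections: "\<And>\<xi>. \<xi> \<in> borel_sections (unit_space G) \<H> \<Longrightarrow>
      (\<lambda>\<gamma>. L \<gamma> (\<xi> (src G \<gamma>))) \<in> borel_sections (arrows G) (pullback (rng G) \<H>)"
    using rep by (simp add: representation_def)
  have iso2: "hilbert_isomorphism (fibre (ell2_bundle \<H>) (src G \<gamma>)) (fibre (ell2_bundle \<H>) (rng G \<gamma>))
      (ell2_map (L \<gamma>))" if "\<gamma> \<in> space (arrows G)" for \<gamma>
    unfolding ell2_bundle_simps by (rule hilbert_isomorphism_ell2[OF iso[OF that]])
  have sections: "(\<lambda>\<gamma>. ell2_map (L \<gamma>) (F (src G \<gamma>))) \<in> borel_sections (arrows G) (pullback (rng G) (ell2_bundle \<H>))"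
    if F: "F \<in> borel_sections (unit_space G) (ell2_bundle \<H>)" for F
  proof -
    have "(\<lambda>x. ell2_nth k (F x)) \<in> borel_sections (unit_space G) \<H>" for k
      using F by (simp only: borel_sections_ell2_iff[OF hb])
    hence "(\<lambda>\<gamma>. L \<gamma> (ell2_nth k (F (src G \<gamma>)))) \<in> borel_sections (arrows G) (pullback (rng G) \<H>)" for k
      by (rule L_sections)
    moreover have "ell2_map (L \<gamma>) (F (src G \<gamma>)) \<in> carrier (ell2 (fibre \<H> (rng G \<gamma>)))"
      if "\<gamma> \<in> space (arrows G)" for \<gamma>
      using hilbert_isomorphism_closed[OF iso2[OF that] borel_sections_carrier[OF F src_in_unit_space[OF that]]]
      by simp
    ultimately show ?thesis
      unfolding pullback_ell2_bundle
        borel_sections_ell2_iff[OF hilbert_bundle_pullback[OF hb rng_measurable_unit]]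
      by simp
  qed
  obtain U where U: "conull_borel G C U" and mult:
    "\<And>\<gamma> \<eta> v. \<lbrakk>\<gamma> \<in> reduction G U; \<eta> \<in> reduction G U; src G \<gamma> = rng G \<eta>;
      v \<in> carrier (fibre \<H> (src G \<eta>))\<rbrakk> \<Longrightarrow> L (\<gamma> \<cdot>\<^bsub>G\<^esub> \<eta>) v = L \<gamma> (L \<eta> v)"
    using rep by (auto simp: representation_def)
  have "ell2_map (L (\<gamma> \<cdot>\<^bsub>G\<^esub> \<eta>)) f = ell2_map (L \<gamma>) (ell2_map (L \<eta>) f)"
    if "\<gamma> \<in> reduction G U" "\<eta> \<in> reduction G U" "src G \<gamma> = rng G \<eta>"
      "f \<in> carrier (fibre (ell2_bundle \<H>) (src G \<eta>))" for \<gamma> \<eta> f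
    by (rule ell2_eqI) (use that mult in simp)
  thus ?thesis
    unfolding representation_def using iso2 sections U by blast
qed

theorem theorem4p8:
  fixes G :: "'g groupoid" and C :: "'g measure set"
  assumes "measured_groupoid G C"
    and "ergodic G C"
    and "\<And>(\<H> :: ('g, vec) bundle_data) L.
           \<lbrakk>hilbert_bundle (unit_space G) \<H>; representation G C \<H> L\<rbrakk>
           \<Longrightarrow> H1 G C \<H> L = {H1_zero G C \<H> L}"
  shows "property_T G C"
  unfolding property_T_def
proof (intro allI impI, elim conjE)
  fix \<H> :: "('g, vec) bundle_data" and L
  assume hb: "hilbert_bundle (unit_space G) \<H>" and rep: "representation G C \<H> L"
    and almost: "almost_contains_unit_invariant_sections G C \<H> L"
  have G: "borel_groupoid G" "measure_class (arrows G) C" "symmetric_class G C" "invariant_class G C"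
    using assms(1) by (auto simp: measured_groupoid_def)
  obtain \<nu> \<kappa> U where \<nu>: "\<nu> \<in> C" "prob_space \<nu>"
    and inv: "disintegration G \<nu> \<kappa>" "conull_borel G C U"
      "\<And>\<gamma>. \<gamma> \<in> reduction G U \<Longrightarrow>
        equivalent_measures (left_translate G \<gamma> (\<kappa> (src G \<gamma>))) (\<kappa> (rng G \<gamma>))"
    using G(4) unfolding invariant_class_def by blast
  interpret measured_groupoid_with_prob G C \<nu>
    by (intro measured_groupoid_with_prob.intro measured_groupoid_with_prob_axioms.intro G \<nu>)
  interpret measured_representation G C \<nu> \<H> L
    by (intro measured_representation.intro measured_representation_axioms.intro
        measured_groupoid_with_prob_axioms hb rep)
  let ?\<H>2 = "ell2_bundle \<H>" and ?L2 = "\<lambda>\<gamma>. ell2_map (L \<gamma>)"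
  have hb2: "hilbert_bundle (unit_space G) ?\<H>2" by (rule hilbert_bundle_ell2[OF hb])
  have rep2: "representation G C ?\<H>2 ?L2" by (rule representation_ell2[OF hb rep G(1)])
  interpret E: measured_representation G C \<nu> ?\<H>2 ?L2
    by (intro measured_representation.intro measured_representation_axioms.intro
        measured_groupoid_with_prob_axioms hb2 rep2)
  obtain U' where U': "conull_borel G C U'" and mult:
    "\<And>\<gamma> \<eta> v. \<lbrakk>\<gamma> \<in> reduction G U'; \<eta> \<in> reduction G U'; src G \<gamma> = rng G \<eta>;
      v \<in> carrier (fibre \<H> (src G \<eta>))\<rbrakk> \<Longrightarrow> L (\<gamma> \<cdot>\<^bsub>G\<^esub> \<eta>) v = L \<gamma> (L \<eta> v)"
    using rep by (auto simp: representation_def)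
  have red: "\<gamma> \<in> space (arrows G)" if "\<gamma> \<in> reduction G A" for \<gamma> A
    using that by (simp add: reduction_def)
  have cobound_mult': "\<delta> \<xi> (\<gamma> \<cdot>\<^bsub>G\<^esub> \<eta>) = \<delta> \<xi> \<gamma> \<oplus>\<^bsub>fibre \<H> (rng G \<gamma>)\<^esub> L \<gamma> (\<delta> \<xi> \<eta>)"
    if "\<xi> \<in> borel_sections (unit_space G) \<H>" "\<gamma> \<in> reduction G U'" "\<eta> \<in> reduction G U'"
      "src G \<gamma> = rng G \<eta>" for \<xi> \<gamma> \<eta>
    by (rule cobound_mult[OF that(1) red[OF that(2)] red[OF that(3)] that(4)])
       (rule mult[OF that(2-4)])

  \<comment> \<open>Almost invariant sections with square-summable coboundaries almost
    everywhere\<close>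
  obtain \<xi>0 where \<xi>0: "\<And>n. unit_section G C \<H> (\<xi>0 n)"
    and lim: "AE \<gamma> in \<nu>. (\<lambda>n. hnorm (fibre \<H> (rng G \<gamma>)) (\<delta> (\<xi>0 n) \<gamma>)) \<longlonglongrightarrow> 0"
    using almost unfolding almost_contains_unit_invariant_sections_def AE_C_iff cobound_def by blast
  have sec0: "\<xi>0 n \<in> borel_sections (unit_space G) \<H>" for n
    using \<xi>0[of n] by (simp add: unit_section_def)
  have "(\<lambda>\<gamma>. hnorm (fibre \<H> (rng G \<gamma>)) (\<delta> (\<xi>0 n) \<gamma>)) \<in> borel_measurable \<nu>" for n
    using borel_measurable_hnorm[OF hilbert_pullback cobound_sections[OF sec0]]
    unfolding pullback_simps measurable_cong_sets[OF sets_\<nu> refl] .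
  then obtain r where r: "AE \<gamma> in \<nu>. summable (\<lambda>k. (hnorm (fibre \<H> (rng G \<gamma>)) (\<delta> (\<xi>0 (r k)) \<gamma>))\<^sup>2)"
    using prob_space.AE_summable_subsequence[OF \<nu>(2) _ lim] by blast
  define \<xi> where "\<xi> k = \<xi>0 (r k)" for k
  have sec: "\<xi> k \<in> borel_sections (unit_space G) \<H>" for k
    unfolding \<xi>_def by (rule sec0)

  \<comment> \<open>Summability for every arrow of an inessential reduction\<close>
  define S where "S = {\<gamma> \<in> space (arrows G). summable (\<lambda>k. (hnorm (fibre \<H> (rng G \<gamma>)) (\<delta> (\<xi> k) \<gamma>))\<^sup>2)}"
  have S_AE: "AE \<gamma> in \<nu>. \<gamma> \<in> S"
    using r AE_space by eventually_elim (simp add: S_def \<xi>_def)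
  have S_quotient: "\<gamma> \<in> S" if \<gamma>: "\<gamma> \<in> reduction G U'" and \<eta>: "\<eta> \<in> reduction G U'"
    and comp: "src G \<gamma> = rng G \<eta>" and prod: "\<gamma> \<cdot>\<^bsub>G\<^esub> \<eta> \<in> S" and \<eta>S: "\<eta> \<in> S" for \<gamma> \<eta>
  proof -
    note \<gamma>G = red[OF \<gamma>] and \<eta>G = red[OF \<eta>]
    interpret K: complex_hilbert_space "fibre \<H> (rng G \<gamma>)" by (rule fibre_rng[OF \<gamma>G])
    let ?K = "fibre \<H> (rng G \<gamma>)"
    let ?g = "\<lambda>k. 2 * (hnorm ?K (\<delta> (\<xi> k) (\<gamma> \<cdot>\<^bsub>G\<^esub> \<eta>)))\<^sup>2
        + 2 * (hnorm (fibre \<H> (rng G \<eta>)) (\<delta> (\<xi> k) \<eta>))\<^sup>2"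
    have summable: "summable ?g"
      using prod \<eta>S rng_mult[OF \<gamma>G \<eta>G comp]
      by (intro summable_add summable_mult) (simp_all add: S_def)
    have "(hnorm ?K (\<delta> (\<xi> k) \<gamma>))\<^sup>2 \<le> ?g k" for k
    proof -
      have d: "\<delta> (\<xi> k) \<gamma> \<in> carrier ?K" by (rule cobound_closed[OF sec \<gamma>G])
      have e: "\<delta> (\<xi> k) \<eta> \<in> carrier (fibre \<H> (src G \<gamma>))"
        unfolding comp by (rule cobound_closed[OF sec \<eta>G])
      have Le: "L \<gamma> (\<delta> (\<xi> k) \<eta>) \<in> carrier ?K" by (rule L_closed[OF \<gamma>G e])
      \<comment> \<open>The cocycle identity solved for its first factor. The second term then has
        the norm of the coboundary at \<eta>, since \<open>L \<gamma>\<close> is isometric.\<close>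
      have "\<delta> (\<xi> k) \<gamma> = \<delta> (\<xi> k) (\<gamma> \<cdot>\<^bsub>G\<^esub> \<eta>) \<ominus>\<^bsub>?K\<^esub> L \<gamma> (\<delta> (\<xi> k) \<eta>)"
        unfolding cobound_mult'[OF sec \<gamma> \<eta> comp]
        using d Le by (simp add: a_minus_def K.a_assoc K.r_neg)
      hence "(hnorm ?K (\<delta> (\<xi> k) \<gamma>))\<^sup>2 \<le>
          2 * (hnorm ?K (\<delta> (\<xi> k) (\<gamma> \<cdot>\<^bsub>G\<^esub> \<eta>)))\<^sup>2 + 2 * (hnorm ?K (L \<gamma> (\<delta> (\<xi> k) \<eta>)))\<^sup>2"
        using K.hnorm_minus_sq_le[of "\<delta> (\<xi> k) (\<gamma> \<cdot>\<^bsub>G\<^esub> \<eta>)" "L \<gamma> (\<delta> (\<xi> k) \<eta>)"] d Le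
          cobound_mult'[OF sec \<gamma> \<eta> comp] by (metis K.add.m_closed)
      thus ?thesis
        using hilbert_isomorphism_hnorm[OF L_iso[OF \<gamma>G] e] by (simp add: comp)
    qed
    hence "summable (\<lambda>k. (hnorm ?K (\<delta> (\<xi> k) \<gamma>))\<^sup>2)"
      by (intro summable_comparison_test'[OF summable, where N = 0]) simp
    thus ?thesis using \<gamma>G by (simp add: S_def)
  qed
  obtain V where V: "conull_borel G C V" "V \<subseteq> U'" "reduction G V \<subseteq> S"
    by (rule reduction_in_conull_set[OF inv(1,2) _ U' S_AE])
       (blast intro: inv(3) S_quotient)+

  \<comment> \<open>The cocycle with values in the countable multiple\<close>
  define b where "b \<gamma> = ell2_pack (\<lambda>k. if \<gamma> \<in> reduction G V then \<delta> (\<xi> k) \<gamma> else \<zero>\<^bsub>fibre \<H> (rng G \<gamma>)\<^esub>)" for \<gamma>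
  have b_sec: "b \<in> borel_sections (arrows G) (pullback (rng G) ?\<H>2)"
    unfolding pullback_ell2_bundle borel_sections_ell2_iff[OF hilbert_pullback]
  proof (intro conjI ballI allI)
    fix \<gamma> assume \<gamma>: "\<gamma> \<in> space (arrows G)"
    interpret K: complex_hilbert_space "fibre \<H> (rng G \<gamma>)" by (rule fibre_rng[OF \<gamma>])
    show "b \<gamma> \<in> carrier (ell2 (fibre (pullback (rng G) \<H>) \<gamma>))"
    \<comment> \<open>Off the reduction the coboundaries may fail to be square-summable, yet a
      section must have values in every fibre; the default zero provides them, and the cocycle
      identity is only claimed on the reduction.\<close>
    proof (cases "\<gamma> \<in> reduction G V")
      case True
      hence "\<gamma> \<in> S" using V(3) by blast
      thus ?thesis using True cobound_closed[OF sec \<gamma>] by (simp add: b_def ell2_carrier_iff S_def)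
    qed (simp add: b_def ell2_carrier_iff)
  next
    fix k
    have V_sets: "V \<in> sets (unit_space G)" using V(1) by (simp add: conull_borel_def)
    have pred: "Measurable.pred (arrows G) (\<lambda>\<gamma>. rng G \<gamma> \<in> V \<and> src G \<gamma> \<in> V)"
      using V_sets by measurable
    show "(\<lambda>\<gamma>. ell2_nth k (b \<gamma>)) \<in> borel_sections (arrows G) (pullback (rng G) \<H>)"
    proof (rule borel_sectionsI)
      fix \<gamma> assume \<gamma>: "\<gamma> \<in> space (arrows G)"
      interpret K: complex_hilbert_space "fibre \<H> (rng G \<gamma>)" by (rule fibre_rng[OF \<gamma>])
      show "ell2_nth k (b \<gamma>) \<in> carrier (fibre (pullback (rng G) \<H>) \<gamma>)"
        using cobound_closed[OF sec \<gamma>] by (simp add: b_def)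
      show "hinner (fibre (pullback (rng G) \<H>) \<gamma>) (ell2_nth k (b \<gamma>)) (fund (pullback (rng G) \<H>) n \<gamma>) =
          (if rng G \<gamma> \<in> V \<and> src G \<gamma> \<in> V then hinner (fibre (pullback (rng G) \<H>) \<gamma>) (\<delta> (\<xi> k) \<gamma>)
            (fund (pullback (rng G) \<H>) n \<gamma>) else 0)" for n
        using \<gamma> hilbert_bundle_fund_closed[OF hb rng_in_unit_space[OF \<gamma>]]
        by (simp add: b_def reduction_def)
    next
      show "(\<lambda>\<gamma>. if rng G \<gamma> \<in> V \<and> src G \<gamma> \<in> V then hinner (fibre (pullback (rng G) \<H>) \<gamma>) (\<delta> (\<xi> k) \<gamma>)
            (fund (pullback (rng G) \<H>) n \<gamma>) else 0) \<in> borel_measurable (arrows G)" for n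
        by (intro measurable_If borel_sections_inner cobound_sections sec measurable_const)
           (use pred in \<open>simp_all add: pred_def\<close>)
    qed
  qed
  have b_mult: "b (\<gamma> \<cdot>\<^bsub>G\<^esub> \<eta>) = b \<gamma> \<oplus>\<^bsub>fibre ?\<H>2 (rng G \<gamma>)\<^esub> ?L2 \<gamma> (b \<eta>)"
    if \<gamma>: "\<gamma> \<in> reduction G V" and \<eta>: "\<eta> \<in> reduction G V" and comp: "src G \<gamma> = rng G \<eta>" for \<gamma> \<eta>
  proof (rule ell2_eqI)
    fix k
    note \<gamma>G = red[OF \<gamma>] and \<eta>G = red[OF \<eta>]
    have "\<gamma> \<in> reduction G U'" "\<eta> \<in> reduction G U'"
      using \<gamma> \<eta> V(2) by (auto simp: reduction_def)
    note cobound = cobound_mult'[OF sec this comp]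
    have "\<gamma> \<cdot>\<^bsub>G\<^esub> \<eta> \<in> reduction G V"
      using \<gamma> \<eta> mult_closed[OF \<gamma>G \<eta>G comp] rng_mult[OF \<gamma>G \<eta>G comp] src_mult[OF \<gamma>G \<eta>G comp]
      by (simp add: reduction_def)
    thus "ell2_nth k (b (\<gamma> \<cdot>\<^bsub>G\<^esub> \<eta>)) = ell2_nth k (b \<gamma> \<oplus>\<^bsub>fibre ?\<H>2 (rng G \<gamma>)\<^esub> ?L2 \<gamma> (b \<eta>))"
      using \<gamma> \<eta> by (simp add: b_def cobound)
  qed
  have "b \<in> cocycles G C ?\<H>2 ?L2"
    unfolding cocycles_def using b_sec V(1) b_mult by blast
  then obtain \<eta> where \<eta>: "\<eta> \<in> borel_sections (unit_space G) ?\<H>2"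
    and b_cobound: "AE \<gamma> in \<nu>. \<zero>\<^bsub>fibre ?\<H>2 (rng G \<gamma>)\<^esub> \<ominus>\<^bsub>fibre ?\<H>2 (rng G \<gamma>)\<^esub> b \<gamma> = E.\<delta> \<eta> \<gamma>"
    by (rule E.H1_zero_imp_coboundary[OF assms(3)[OF hb2 rep2]])

  \<comment> \<open>Exactly invariant sections and their nonvanishing\<close>
  define \<zeta> where "\<zeta> k x = \<xi> k x \<oplus>\<^bsub>fibre \<H> x\<^esub> ell2_nth k (\<eta> x)" for k x
  have \<eta>_sec: "(\<lambda>x. ell2_nth k (\<eta> x)) \<in> borel_sections (unit_space G) \<H>" for k
    using \<eta> by (simp only: borel_sections_ell2_iff[OF hb])
  have \<zeta>_sec: "\<zeta> k \<in> borel_sections (unit_space G) \<H>" for k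
    unfolding \<zeta>_def by (rule borel_sections_add[OF hb sec \<eta>_sec])
  have \<zeta>_inv: "AE \<gamma> in \<nu>. \<zeta> k (rng G \<gamma>) = L \<gamma> (\<zeta> k (src G \<gamma>))" for k
    \<comment> \<open>On the reduction the k-th component of \<open>b\<close> is the coboundary of
      \<open>\<xi> k\<close> and not the default zero, so the k-th component of the equation for
      \<open>b\<close> says that \<open>\<xi> k\<close> and the k-th component of \<eta> have
      opposite coboundaries.\<close>
    using b_cobound AE_reduction[OF V(1)]
  proof eventually_elim
    case (elim \<gamma>)
    note \<gamma> = red[OF elim(2)]
    interpret K: hilbert_multiple "fibre \<H> (rng G \<gamma>)"
      by (rule hilbert_bundle_multiple[OF hb rng_in_unit_space[OF \<gamma>]])
    note r = borel_sections_carrier[OF sec rng_in_unit_space[OF \<gamma>], of k]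
      borel_sections_carrier[OF \<eta>_sec rng_in_unit_space[OF \<gamma>], of k]
    note s = borel_sections_carrier[OF sec src_in_unit_space[OF \<gamma>], of k]
      borel_sections_carrier[OF \<eta>_sec src_in_unit_space[OF \<gamma>], of k]
    have b: "b \<gamma> \<in> carrier (ell2 (fibre \<H> (rng G \<gamma>)))"
      using borel_sections_carrier[OF b_sec \<gamma>] by simp
    have \<eta>c: "\<eta> (rng G \<gamma>) \<in> carrier (ell2 (fibre \<H> (rng G \<gamma>)))"
        "ell2_map (L \<gamma>) (\<eta> (src G \<gamma>)) \<in> carrier (ell2 (fibre \<H> (rng G \<gamma>)))"
      using borel_sections_carrier[OF \<eta> rng_in_unit_space[OF \<gamma>]]
        E.L_closed[OF \<gamma> borel_sections_carrier[OF \<eta> src_in_unit_space[OF \<gamma>]]] by simp_all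
    have "ell2_nth k (\<zero>\<^bsub>ell2 (fibre \<H> (rng G \<gamma>))\<^esub> \<ominus>\<^bsub>ell2 (fibre \<H> (rng G \<gamma>))\<^esub> b \<gamma>) =
        ell2_nth k (\<eta> (rng G \<gamma>) \<ominus>\<^bsub>ell2 (fibre \<H> (rng G \<gamma>))\<^esub> ell2_map (L \<gamma>) (\<eta> (src G \<gamma>)))"
      using elim(1) by (simp only: cobound_def ell2_bundle_simps)
    hence "\<zero>\<^bsub>fibre \<H> (rng G \<gamma>)\<^esub> \<ominus>\<^bsub>fibre \<H> (rng G \<gamma>)\<^esub>
        (\<xi> k (rng G \<gamma>) \<ominus>\<^bsub>fibre \<H> (rng G \<gamma>)\<^esub> L \<gamma> (\<xi> k (src G \<gamma>))) =
        ell2_nth k (\<eta> (rng G \<gamma>)) \<ominus>\<^bsub>fibre \<H> (rng G \<gamma>)\<^esub> L \<gamma> (ell2_nth k (\<eta> (src G \<gamma>)))"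
      unfolding K.ell2_nth_minus[OF K.ell2_zero_closed b] K.ell2_nth_minus[OF \<eta>c]
      using elim(2) by (simp add: b_def cobound_def)
    hence "\<zeta> k (rng G \<gamma>) =
        L \<gamma> (\<xi> k (src G \<gamma>)) \<oplus>\<^bsub>fibre \<H> (rng G \<gamma>)\<^esub> L \<gamma> (ell2_nth k (\<eta> (src G \<gamma>)))"
      unfolding \<zeta>_def by (intro K.cobound_opposite r L_closed[OF \<gamma>] s)
    thus ?case
      unfolding \<zeta>_def hilbert_isomorphism_add[OF L_iso[OF \<gamma>] s] .
  qed
  have "AE x in r\<nu>. \<forall>k. hnorm (fibre \<H> x) (\<xi> k x) = 1"
    using \<xi>0 by (simp add: AE_all_countable unit_section_def AE_unit_class_iff \<xi>_def)
  hence "AE x in r\<nu>. \<exists>k. hnorm (fibre \<H> x) (\<zeta> k x) \<noteq> 0"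
    using AE_space
  proof eventually_elim
    case (elim x)
    hence x: "x \<in> space (unit_space G)" by simp
    interpret complex_hilbert_space "fibre \<H> x" by (rule hilbert_bundle_fibre[OF hb x])
    show ?case
    proof (rule ccontr)
      assume "\<not> ?thesis"
      hence zero: "hnorm (fibre \<H> x) (\<zeta> k x) = 0" for k by simp
      \<comment> \<open>The constant comes from writing a unit vector as zero minus a component of
        \<eta>: the squared inequality gives 1 on the left and twice the squared norm of that
        component on the right.\<close>
      have half: "(hnorm (fibre \<H> x) (ell2_nth k (\<eta> x)))\<^sup>2 \<ge> 1 / 2" for k
      proof -
        note c = borel_sections_carrier[OF sec x, of k] borel_sections_carrier[OF \<eta>_sec x, of k]
        have "\<xi> k x = \<zeta> k x \<ominus>\<^bsub>fibre \<H> x\<^esub> ell2_nth k (\<eta> x)"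
          unfolding \<zeta>_def using c by (simp add: a_minus_def a_assoc r_neg)
        hence "(hnorm (fibre \<H> x) (\<xi> k x))\<^sup>2 \<le>
            2 * (hnorm (fibre \<H> x) (\<zeta> k x))\<^sup>2 + 2 * (hnorm (fibre \<H> x) (ell2_nth k (\<eta> x)))\<^sup>2"
          using hnorm_minus_sq_le[OF borel_sections_carrier[OF \<zeta>_sec x] c(2), of k] by simp
        thus ?thesis using elim(1) zero by simp
      qed
      have "(\<lambda>k. (hnorm (fibre \<H> x) (ell2_nth k (\<eta> x)))\<^sup>2) \<longlonglongrightarrow> 0"
        using borel_sections_carrier[OF \<eta> x] by (intro summable_LIMSEQ_zero) (simp add: ell2_carrier_iff)
      hence "1 / 2 \<le> (0 :: real)"
        by (rule LIMSEQ_le_const) (use half in blast)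
      thus False by simp
    qed
  qed
  thus "contains_unit_invariant_section G C \<H> L"
    by (rule invariant_sections_imp_unit_invariant[OF \<zeta>_sec \<zeta>_inv])
qed

end
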